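(* Let $\Omega=(-B,B)^d\subset\mathbb{R}^d$ with $B>0$, and let $k$ be the Gaussian kernel $k(\mathbf{x},\mathbf{x}')=\sigma^2\exp\left(-\frac{\|\mathbf{x}-\mathbf{x}'\|_2^2}{2\ell^2}\right)$ with $\sigma^2>0$, $\ell>0$. Suppose $L>B$. Then $$\sup_{\mathbf{x},\mathbf{t}\in\Omega}\bigl|\hat k_\infty(\mathbf{x},\mathbf{t})-k(\mathbf{x},\mathbf{t})\bigr|\le\sigma^2(2^d+2d-1)\left(3+\frac{\sqrt{2\pi}\,\ell}{4L}\right)^{d}\exp\left(-\frac{2(L-B)^2}{\ell^2}\right).$$ Moreover, if $L>\ell\sqrt{\pi/2}$, then for $m\in\mathbb{N}$, $m\ge 1$, $$\sup_{\mathbf{x},\mathbf{t}\in\Omega}\bigl|\hat k_\infty(\mathbf{x},\mathbf{t})-\hat k_m(\mathbf{x},\mathbf{t})\bigr|\le\frac{4\sqrt2}{\pi^{3/2}\ell}\,3^{d-1}d\,\sigma^2\,\frac{L}{m}\exp\left(-\frac{\pi^2\ell^2m^2}{8L^2}\right).$$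
   Context: The Hilbert space Gaussian process (HSGP) approximations of $k$ are $$\hat k_\infty(\mathbf{x},\mathbf{x}'):=\sum_{\mathbf{j}\in\mathbb{Z}_+^d}S\left(\frac{\pi\mathbf{j}}{2L}\right)\phi_{\mathbf{j}}(\mathbf{x})\phi_{\mathbf{j}}(\mathbf{x}'),\qquad \hat k_m(\mathbf{x},\mathbf{x}'):=\sum_{\mathbf{j}\in\{1,\dots,m\}^d}S\left(\frac{\pi\mathbf{j}}{2L}\right)\phi_{\mathbf{j}}(\mathbf{x})\phi_{\mathbf{j}}(\mathbf{x}'),$$ where $\mathbb{Z}_+=\{1,2,\dots\}$, the sine basis is $$\phi_{\mathbf{j}}(\mathbf{x}):=L^{-d/2}\prod_{r=1}^d\sin\left(\frac{\pi j_r}{2L}(x_r+L)\right),$$ and the spectral density of the Gaussian kernel (its Fourier transform $S(\omega)=\int_{\mathbb{R}^d}k(\mathbf{h})e^{-i\omega^{T}\mathbf{h}}d\mathbf{h}$, with $k(\mathbf{x},\mathbf{x}')=k(\mathbf{x}-\mathbf{x}')$) is $$S(\omega)=\sigma^2(2\pi)^{d/2}\ell^d\exp\left(-\frac{\ell^2\|\omega\|_2^2}{2}\right).$$ *)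

theory Defs
  imports "HOL-Probability.Probability"
begin

definition gaussian_kernel :: "real \<Rightarrow> real \<Rightarrow> real^'d \<Rightarrow> real^'d \<Rightarrow> real" where
  "gaussian_kernel \<sigma> l x x' = \<sigma>\<^sup>2 * exp (- (norm (x - x'))\<^sup>2 / (2 * l\<^sup>2))"

text \<open>
  The Fourier transform, without normalising factor, of the profile \<open>h \<mapsto> k h 0\<close>. It is
  meaningful for stationary kernels, for which \<open>k x x' = k (x - x') 0\<close>. The transform is real
  because the profile is even; \<^const>\<open>Re\<close> only adjusts the type (see
  \<open>gaussian_fourier_integral\<close> below).
\<close>
definition spectral_density :: "(real^'d \<Rightarrow> real^'d \<Rightarrow> real) \<Rightarrow> real^'d \<Rightarrow> real" where
  "spectral_density k \<omega> =
     Re (LINT h|lborel. complex_of_real (k h 0) * exp (- (\<i> * complex_of_real (\<omega> \<bullet> h))))"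

definition sine_basis :: "real \<Rightarrow> nat^'d \<Rightarrow> real^'d \<Rightarrow> real" where
  "sine_basis L j x =
     L powr (- real CARD('d) / 2) * (\<Prod>r\<in>UNIV. sin (pi * real (j $ r) / (2 * L) * (x $ r + L)))"

definition hsgp_frequency :: "real \<Rightarrow> nat^'d \<Rightarrow> real^'d" where
  "hsgp_frequency L j = (\<chi> r. pi * real (j $ r) / (2 * L))"

definition hsgp_term ::
  "(real^'d \<Rightarrow> real^'d \<Rightarrow> real) \<Rightarrow> real \<Rightarrow> real^'d \<Rightarrow> real^'d \<Rightarrow> nat^'d \<Rightarrow> real" where
  "hsgp_term k L x x' j =
     spectral_density k (hsgp_frequency L j) * sine_basis L j x * sine_basis L j x'"

text \<open>
  An unordered (absolutely convergent) sum over the multi-indices with all entries positive. For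
  the Gaussian kernel it converges for all \<open>x\<close> and \<open>x'\<close>: see \<open>summable_hsgp_gaussian\<close> below.
\<close>
definition hsgp_infinite ::
  "(real^'d \<Rightarrow> real^'d \<Rightarrow> real) \<Rightarrow> real \<Rightarrow> real^'d \<Rightarrow> real^'d \<Rightarrow> real" where
  "hsgp_infinite k L x x' = (\<Sum>\<^sub>\<infinity>j\<in>{j. \<forall>r. j $ r \<ge> 1}. hsgp_term k L x x' j)"

definition hsgp_truncated ::
  "(real^'d \<Rightarrow> real^'d \<Rightarrow> real) \<Rightarrow> real \<Rightarrow> nat \<Rightarrow> real^'d \<Rightarrow> real^'d \<Rightarrow> real" where
  "hsgp_truncated k L m x x' = (\<Sum>j\<in>{j. \<forall>r. j $ r \<in> {1..m}}. hsgp_term k L x x' j)"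

lemma finite_multi_indices: "finite {j :: nat^'d. \<forall>r. j $ r \<in> {1..m}}"
proof -
  have "{j :: nat^'d. \<forall>r. j $ r \<in> {1..m}} = vec_lambda ` (\<Pi>\<^sub>E r\<in>UNIV. {1..m})"
  proof (intro set_eqI iffI)
    fix j :: "nat^'d" assume "j \<in> {j. \<forall>r. j $ r \<in> {1..m}}"
    then have "vec_nth j \<in> (\<Pi>\<^sub>E r\<in>UNIV. {1..m})" by (auto simp: PiE_def Pi_def)
    then show "j \<in> vec_lambda ` (\<Pi>\<^sub>E r\<in>UNIV. {1..m})"
      by (metis image_eqI vec_nth_inverse)
  qed auto
  then show ?thesis by (simp add: finite_PiE)
qed

lemma gaussian_fourier_real:
  fixes l w :: real
  assumes l: "l > 0"
  defines "f \<equiv> \<lambda>x. complex_of_real (exp (- x\<^sup>2 / (2 * l\<^sup>2))) * exp (- (\<i> * complex_of_real (w * x)))"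
  shows "integrable lborel f"
    and "integral\<^sup>L lborel f = complex_of_real (sqrt (2 * pi) * l * exp (- l\<^sup>2 * w\<^sup>2 / 2))"
proof -
  define g where "g = (\<lambda>x. complex_of_real (exp (- x\<^sup>2 / 2)) * exp (- (\<i> * complex_of_real (w * l * x))))"
  have gf: "f (0 + l * x) = g x" for x
    using l by (simp add: f_def g_def power_mult_distrib field_simps)
  have g_eq: "g x = sqrt (2 * pi) * (std_normal_density x *\<^sub>R iexp (- (w * l) * x))" for x
    by (simp add: g_def std_normal_density_def scaleR_conv_of_real mult_ac)
  have int0: "integrable lborel (\<lambda>x. std_normal_density x *\<^sub>R iexp (- (w * l) * x))"
  proof (rule Bochner_Integration.integrable_bound[OF integrable_normal_density[of 1 0]])
    show "AE x in lborel. norm (std_normal_density x *\<^sub>R iexp (- (w * l) * x)) \<le> norm (std_normal_density x)"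
      by (simp add: norm_mult)
  qed auto
  have intg: "integrable lborel g"
    unfolding g_eq[abs_def] by (intro integrable_mult_right int0)
  have "integrable lborel (\<lambda>x. f (0 + l * x))" using intg by (simp only: gf)
  then show "integrable lborel f"
    using lborel_integrable_real_affine_iff[of l f 0] l by simp
  have "(CLINT x|lborel. std_normal_density x *\<^sub>R iexp (- (w * l) * x)) = char std_normal_distribution (- (w * l))"
    unfolding char_def by (subst integral_density) auto
  also have "\<dots> = complex_of_real (exp (- l\<^sup>2 * w\<^sup>2 / 2))"
    by (simp add: char_std_normal_distribution power_mult_distrib mult_ac)
  finally have "integral\<^sup>L lborel g = complex_of_real (sqrt (2 * pi) * exp (- l\<^sup>2 * w\<^sup>2 / 2))"
    unfolding g_eq[abs_def] by (subst integral_mult_right_zero) simp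
  moreover have "integral\<^sup>L lborel f = l *\<^sub>R integral\<^sup>L lborel g"
    using lborel_integral_real_affine[of l f 0] l by (simp only: gf) simp
  ultimately show "integral\<^sup>L lborel f = complex_of_real (sqrt (2 * pi) * l * exp (- l\<^sup>2 * w\<^sup>2 / 2))"
    by (simp add: scaleR_conv_of_real mult_ac)
qed

lemma gaussian_fourier_integral:
  fixes \<omega> :: "real^'d"
  assumes l: "l > 0"
  shows "(LINT h|lborel. complex_of_real (gaussian_kernel \<sigma> l h 0) * exp (- (\<i> * complex_of_real (\<omega> \<bullet> h)))) =
    complex_of_real (\<sigma>\<^sup>2 * (2 * pi) powr (real CARD('d) / 2) * l ^ CARD('d) * exp (- l\<^sup>2 * (norm \<omega>)\<^sup>2 / 2))"
proof -
  interpret product_sigma_finite "\<lambda>_::real^'d. lborel :: real measure" by standard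
  let ?B = "Basis :: (real^'d) set"
  let ?F = "\<lambda>h :: real^'d. complex_of_real (gaussian_kernel \<sigma> l h 0) * exp (- (\<i> * complex_of_real (\<omega> \<bullet> h)))"
  define f where "f = (\<lambda>(b::real^'d) x. complex_of_real (exp (- x\<^sup>2 / (2 * l\<^sup>2))) * exp (- (\<i> * complex_of_real ((\<omega> \<bullet> b) * x))))"
  have sq: "(norm v)\<^sup>2 = (\<Sum>b\<in>?B. (v \<bullet> b)\<^sup>2)" for v :: "real^'d"
    unfolding power2_norm_eq_inner by (subst euclidean_inner) (simp only: power2_eq_square)
  have F: "?F (\<Sum>b\<in>?B. y b *\<^sub>R b) = complex_of_real (\<sigma>\<^sup>2) * (\<Prod>b\<in>?B. f b (y b))" for y
  proof -
    let ?h = "\<Sum>b\<in>?B. y b *\<^sub>R b"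
    have c: "?h \<bullet> b = y b" if "b \<in> ?B" for b
      using that by (rule inner_sum_left_Basis)
    have "(norm ?h)\<^sup>2 = (\<Sum>b\<in>?B. (y b)\<^sup>2)" unfolding sq using c by simp
    then have 1: "exp (- (norm ?h)\<^sup>2 / (2 * l\<^sup>2)) = (\<Prod>b\<in>?B. exp (- (y b)\<^sup>2 / (2 * l\<^sup>2)))"
      by (simp add: sum_divide_distrib sum_negf flip: exp_sum)
    have "\<omega> \<bullet> ?h = (\<Sum>b\<in>?B. (\<omega> \<bullet> b) * y b)"
      by (simp add: inner_sum_right mult.commute)
    then have 2: "exp (- (\<i> * complex_of_real (\<omega> \<bullet> ?h))) = (\<Prod>b\<in>?B. exp (- (\<i> * complex_of_real ((\<omega> \<bullet> b) * y b))))"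
      by (simp add: sum_distrib_left sum_negf flip: exp_sum)
    show ?thesis
      unfolding gaussian_kernel_def diff_zero of_real_mult 1 2 of_real_prod f_def prod.distrib
      by (simp only: mult.assoc)
  qed
  have meas: "?F \<in> borel_measurable borel"
    unfolding gaussian_kernel_def by (intro borel_measurable_continuous_onI continuous_intros) (use l in auto)
  have "integral\<^sup>L lborel ?F = (LINT y|(\<Pi>\<^sub>M b\<in>?B. lborel). ?F (\<Sum>b\<in>?B. y b *\<^sub>R b))"
    by (subst lborel_eq, rule integral_distr[OF _ meas]) measurable
  also have "\<dots> = complex_of_real (\<sigma>\<^sup>2) * (LINT y|(\<Pi>\<^sub>M b\<in>?B. lborel). (\<Prod>b\<in>?B. f b (y b)))"
    unfolding F by (rule integral_mult_right_zero)
  also have "(LINT y|(\<Pi>\<^sub>M b\<in>?B. lborel). (\<Prod>b\<in>?B. f b (y b))) = (\<Prod>b\<in>?B. integral\<^sup>L lborel (f b))"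
    by (rule product_integral_prod) (auto simp: f_def intro!: gaussian_fourier_real(1)[OF l, simplified])
  also have "\<dots> = (\<Prod>b\<in>?B. complex_of_real (sqrt (2 * pi) * l * exp (- l\<^sup>2 * (\<omega> \<bullet> b)\<^sup>2 / 2)))"
    unfolding f_def by (intro prod.cong refl gaussian_fourier_real(2)[OF l])
  also have "\<dots> = complex_of_real (sqrt (2 * pi) ^ CARD('d) * l ^ CARD('d) * (\<Prod>b\<in>?B. exp (- l\<^sup>2 * (\<omega> \<bullet> b)\<^sup>2 / 2)))"
    by (simp add: prod.distrib power_mult_distrib)
  also have "(\<Prod>b\<in>?B. exp (- l\<^sup>2 * (\<omega> \<bullet> b)\<^sup>2 / 2)) = exp (- l\<^sup>2 * (norm \<omega>)\<^sup>2 / 2)"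
    unfolding sq by (simp add: sum_divide_distrib sum_negf sum_distrib_left flip: exp_sum)
  also have "sqrt (2 * pi) ^ CARD('d) = (2 * pi) powr (real CARD('d) / 2)"
    by (simp add: powr_half_sqrt[symmetric] powr_powr powr_realpow[symmetric])
  finally show ?thesis by (simp add: mult_ac)
qed

lemma spectral_density_gaussian:
  fixes \<omega> :: "real^'d"
  assumes "l > 0"
  shows "spectral_density (gaussian_kernel \<sigma> l) \<omega> =
    \<sigma>\<^sup>2 * (2 * pi) powr (real CARD('d) / 2) * l ^ CARD('d) * exp (- l\<^sup>2 * (norm \<omega>)\<^sup>2 / 2)"
  unfolding spectral_density_def gaussian_fourier_integral[OF assms] by (rule Re_complex_of_real)

lemma summable_hsgp_gaussian:
  fixes x x' :: "real^'d"
  assumes l: "l > 0" and L: "L > 0"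
  shows "(\<lambda>j. norm (hsgp_term (gaussian_kernel \<sigma> l) L x x' j)) summable_on {j. \<forall>r. j $ r \<ge> 1}"
proof -
  let ?J = "{j :: nat^'d. \<forall>r. j $ r \<ge> 1}"
  define q where "q = exp (- (l\<^sup>2 * pi\<^sup>2 / (8 * L\<^sup>2)))"
  define A where "A = \<sigma>\<^sup>2 * (2 * pi) powr (real CARD('d) / 2) * l ^ CARD('d)"
  define M where "M = L powr (- real CARD('d) / 2)"
  have A: "A \<ge> 0" and M: "M \<ge> 0" using l by (auto simp: A_def M_def)
  have q: "0 < q" "q < 1" using l L by (auto simp: q_def)
  have "Infinite_Set_Sum.abs_summable_on (\<lambda>n::nat. q ^ n) {1..}"
    by (rule abs_summable_on_subset[of _ UNIV])
       (use q in \<open>auto simp: abs_summable_on_nat_iff' summable_geometric\<close>)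
  then have "Infinite_Set_Sum.abs_summable_on (\<lambda>g. \<Prod>r\<in>(UNIV::'d set). q ^ g r) (\<Pi>\<^sub>E r\<in>UNIV. {1..})"
    by (intro abs_summable_on_prod_PiE) (auto simp: countableI_type)
  then have "(\<lambda>g. norm (\<Prod>r\<in>(UNIV::'d set). q ^ g r)) summable_on (\<Pi>\<^sub>E r\<in>UNIV. {1..})"
    by (simp only: abs_summable_equivalent)
  also have "(\<Pi>\<^sub>E r\<in>(UNIV::'d set). {1::nat..}) = vec_nth ` ?J"
  proof (intro set_eqI iffI)
    fix g :: "'d \<Rightarrow> nat" assume "g \<in> (\<Pi>\<^sub>E r\<in>UNIV. {1..})"
    then have "vec_lambda g \<in> ?J" by (auto simp: PiE_def Pi_def)
    then show "g \<in> vec_nth ` ?J" by (metis image_eqI vec_lambda_inverse UNIV_I)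
  qed auto
  finally have "(\<lambda>j. \<Prod>r\<in>UNIV. q ^ (j $ r)) summable_on ?J"
    using q by (subst (asm) summable_on_reindex)
      (auto simp: inj_on_def vec_eq_iff o_def abs_prod)
  then have sq: "(\<lambda>j. A * M * M * (\<Prod>r\<in>UNIV. q ^ (j $ r))) summable_on ?J"
    by (rule summable_on_cmult_right)
  have bd: "\<bar>sine_basis L j y\<bar> \<le> M" for j and y :: "real^'d"
  proof -
    have "\<bar>\<Prod>r\<in>UNIV. sin (pi * real (j $ r) / (2 * L) * (y $ r + L))\<bar> \<le> 1"
      unfolding abs_prod by (intro prod_le_1) auto
    then show ?thesis
      unfolding sine_basis_def abs_mult M_def[symmetric] using M by (simp add: mult_left_le)
  qed
  have S: "spectral_density (gaussian_kernel \<sigma> l) (hsgp_frequency L j) \<in> {0..A * (\<Prod>r\<in>UNIV. q ^ (j $ r))}"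
    for j :: "nat^'d"
  proof -
    let ?w = "hsgp_frequency L j"
    have "(norm ?w)\<^sup>2 = (\<Sum>r\<in>UNIV. (pi * real (j $ r) / (2 * L))\<^sup>2)"
      by (simp add: hsgp_frequency_def norm_vec_def L2_set_def sum_nonneg power_divide)
    then have "- l\<^sup>2 * (norm ?w)\<^sup>2 / 2 = (\<Sum>r\<in>UNIV. - (l\<^sup>2 * pi\<^sup>2 / (8 * L\<^sup>2)) * real ((j $ r)\<^sup>2))"
      by (simp add: sum_distrib_left sum_divide_distrib sum_negf power_mult_distrib power_divide field_simps)
    then have "exp (- l\<^sup>2 * (norm ?w)\<^sup>2 / 2) = (\<Prod>r\<in>UNIV. q ^ ((j $ r)\<^sup>2))"
      by (simp only: exp_sum finite q_def exp_of_nat2_mult)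
    also have "\<dots> \<le> (\<Prod>r\<in>UNIV. q ^ (j $ r))"
      using q by (intro prod_mono conjI power_decreasing) (auto simp: power2_nat_le_imp_le power2_eq_square)
    finally show ?thesis
      unfolding spectral_density_gaussian[OF l] A_def[symmetric] using A by (auto intro: mult_left_mono)
  qed
  show ?thesis
  proof (rule summable_on_comparison_test[OF sq])
    fix j :: "nat^'d"
    let ?P = "\<Prod>r\<in>UNIV. q ^ (j $ r)"
    have "norm (hsgp_term (gaussian_kernel \<sigma> l) L x x' j) \<le> (A * ?P) * M * M"
      unfolding hsgp_term_def real_norm_def abs_mult
      using S[of j] bd[of j x] bd[of j x'] M by (intro mult_mono) (auto intro!: mult_nonneg_nonneg)
    then show "norm (hsgp_term (gaussian_kernel \<sigma> l) L x x' j) \<le> A * M * M * ?P"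
      by (simp add: mult_ac)
  qed auto
qed

end

theory Submission
  imports Defs
begin

text \<open>
  The spectral density of the Gaussian kernel and the sine basis both factor over the coordinates.
  Hence the full and the truncated expansions are \<open>\<sigma>\<^sup>2\<close> times a product, over the coordinates, of
  values of one one-dimensional sine series or of its partial sums
  (\<open>infsum_hsgp_term_gaussian\<close>), and the kernel is such a product of Gaussians
  (\<open>gaussian_kernel_eq_prod\<close>). If all factors are bounded by \<open>2\<close> and corresponding factors differ by at
  most \<open>\<epsilon>\<close>, the products differ by at most \<open>d * 2 ^ (d - 1) * \<epsilon>\<close> (\<open>abs_prod_diff_le\<close>), so only
  dimension one is left. The bound by \<open>2\<close> is a comparison of the sum with the Gaussian integral
  (\<open>abs_suminf_sine_term_le_2\<close>).

  For the error of the full series, write the product of two sines as a difference of cosines. By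
  Poisson summation each of the two cosine series is, up to a constant term that cancels, a sum of
  Gaussians over a lattice of spacing \<open>4 L\<close>, and the sine series is the Gaussian of \<open>x - t\<close> plus
  contributions of mirror images of \<open>t\<close> with alternating signs (\<open>suminf_sine_term_eq_images\<close>). The
  images are at distance at least \<open>2 (L - B)\<close> from \<open>x\<close>, whence the exponential factor
  (\<open>abs_sine_series_minus_gauss_le\<close>). For the error of the truncation, the tail of the sine series is
  dominated by a geometric series (\<open>abs_sine_series_tail_le\<close>).

  Poisson summation (\<open>gauss_periodized_eq_theta\<close>) rests on the fact that a continuous periodic function
  with vanishing Fourier coefficients is zero (\<open>periodic_eq_zero_if_fourier_coeffs_zero\<close>), which
  follows from the Stone-Weierstrass theorem on the unit circle.
\<close>

section \<open>Continuous periodic functions are determined by their Fourier coefficients\<close>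

text \<open>
  A set of functions given by its generators, so that closure under products and the vanishing of
  integrals against a fixed function are proved by induction, without normal forms.
\<close>
inductive trig_poly :: "(real \<Rightarrow> complex) \<Rightarrow> bool" where
  trig_poly_monom: "trig_poly (\<lambda>x. c * cis (of_int k * x))"
| trig_poly_add: "trig_poly f \<Longrightarrow> trig_poly g \<Longrightarrow> trig_poly (\<lambda>x. f x + g x)"

lemma trig_poly_mult:
  assumes "trig_poly f" "trig_poly g"
  shows "trig_poly (\<lambda>x. f x * g x)"
  using assms(1)
proof induction
  case (trig_poly_monom c k)
  show ?case
    using assms(2)
  proof induction
    case (trig_poly_monom d n)
    have "(\<lambda>x. (c * cis (of_int k * x)) * (d * cis (of_int n * x))) = (\<lambda>x. (c * d) * cis (of_int (k + n) * x))"
      by (simp add: fun_eq_iff cis_mult[symmetric] distrib_right)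
    then show ?case by (simp only: trig_poly.trig_poly_monom)
  next
    case (trig_poly_add f g)
    then show ?case by (simp add: distrib_left trig_poly.trig_poly_add)
  qed
next
  case (trig_poly_add f g)
  then show ?case by (simp add: distrib_right trig_poly.trig_poly_add)
qed

text \<open>
  A real-linear function of \<open>cis x = cos x + \<i> sin x\<close> is a combination of \<open>cis x\<close> and \<open>cis (- x)\<close>;
  products of such are covered by closure under multiplication. This turns polynomial
  approximation on the unit circle into trigonometric approximation.
\<close>
lemma trig_poly_real_polynomial_cis:
  assumes "real_polynomial_function (p :: complex \<Rightarrow> real)"
  shows "trig_poly (\<lambda>x. of_real (p (cis x)))"
  using assms
proof induction
  case (linear h)
  interpret bounded_linear h by fact
  have "of_real (h (cis x)) = (h 1 - \<i> * h \<i>) / 2 * cis (of_int 1 * x) + (h 1 + \<i> * h \<i>) / 2 * cis (of_int (- 1) * x)" for x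
  proof -
    have "cis x = cos x *\<^sub>R 1 + sin x *\<^sub>R \<i>"
      by (simp add: complex_eq_iff)
    then have "h (cis x) = cos x * h 1 + sin x * h \<i>"
      by (simp only: add scaleR real_scaleR_def)
    then show ?thesis by (simp add: complex_eq_iff field_simps)
  qed
  then show ?case
    by (simp only:) (intro trig_poly_add trig_poly_monom)
next
  case (const c)
  then show ?case using trig_poly_monom[of "of_real c" 0] by simp
qed (simp_all add: trig_poly_add trig_poly_mult)

lemma trig_poly_continuous: "trig_poly f \<Longrightarrow> continuous_on A f"
  by (induction rule: trig_poly.induct) (auto intro!: continuous_intros)

lemma integral_trig_poly_zero:
  fixes D :: "real \<Rightarrow> real"
  assumes "trig_poly f" "continuous_on UNIV D"
    and "\<And>k::int. integral {0..2 * pi} (\<lambda>x. D x *\<^sub>R cis (of_int k * x)) = 0"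
  shows "integral {0..2 * pi} (\<lambda>x. D x *\<^sub>R f x) = 0"
  using assms(1)
proof induction
  case (trig_poly_monom c k)
  have "(\<lambda>x. D x *\<^sub>R (c * cis (of_int k * x))) = (\<lambda>x. c * (D x *\<^sub>R cis (of_int k * x)))"
    by (simp add: fun_eq_iff)
  then show ?case using assms(3)[of k] by (simp only: integral_mult_right) simp
next
  case (trig_poly_add f g)
  have "continuous_on {0..2*pi} (\<lambda>x. D x *\<^sub>R f x)" "continuous_on {0..2*pi} (\<lambda>x. D x *\<^sub>R g x)"
    using trig_poly_add.hyps trig_poly_continuous continuous_on_subset[OF assms(2)]
    by (auto intro!: continuous_intros)
  then show ?case
    using trig_poly_add.IH
    by (simp add: scaleR_add_right integral_add integrable_continuous_real)
qed

lemma periodic_int_shift: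
  fixes D :: "real \<Rightarrow> 'a"
  assumes "\<And>x. D (x + p) = D x"
  shows "D (x + of_int n * p) = D x"
proof -
  have nat: "D (y + of_nat m * p) = D y" for y m
  proof (induction m)
    case (Suc m)
    have "D (y + of_nat (Suc m) * p) = D ((y + of_nat m * p) + p)" by (simp add: algebra_simps)
    then show ?case using Suc assms by simp
  qed simp
  show ?thesis
  proof (cases "n \<ge> 0")
    case True
    then show ?thesis using nat[of x "nat n"] by simp
  next
    case False
    then show ?thesis using nat[of "x + of_int n * p" "nat (- n)"] by simp
  qed
qed

text \<open>
  A continuous periodic function descends to the circle. No branch of the argument is continuous
  on all of the circle, but the branches with cuts along the negative and along the positive half
  line differ by a period, and their points of discontinuity are disjoint.
\<close>
lemma continuous_periodic_of_Arg:
  fixes D :: "real \<Rightarrow> real"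
  assumes cont: "continuous_on UNIV D" and per: "\<And>x. D (x + 2 * pi) = D x"
  shows "continuous_on (sphere 0 1) (\<lambda>z. D (Arg z))" and "D (Arg (cis x)) = D x"
proof -
  have eq: "D x = D y" if "cis x = cis y" for x y
  proof -
    have "sin x = sin y \<and> cos x = cos y" using that by (simp add: complex_eq_iff)
    then obtain n :: int where "x = y + 2 * pi * of_int n"
      unfolding sin_cos_eq_iff by blast
    then have "x = y + of_int n * (2 * pi)" by (simp only: mult.commute)
    then show ?thesis using periodic_int_shift[of D "2 * pi" y n] per by simp
  qed
  have cisArg: "cis (Arg z) = z" if "norm z = 1" for z
    using that by (subst cis_Arg) (auto simp: sgn_eq)
  show 2: "D (Arg (cis x)) = D x" for x
    by (rule eq) (simp add: cisArg)
  have Arg2: "cis (Arg2pi z) = z" if "norm z = 1" for z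
    using that Arg2pi_eq[of z] by (simp add: cis_conv_exp)
  \<comment> \<open>On the cut of one branch the function is computed with the other.\<close>
  have *: "D (Arg z) = D (Arg2pi z)" if "norm z = 1" for z
    using that by (intro eq) (simp add: cisArg Arg2)
  have D: "isCont D y" for y using cont by (simp add: continuous_on_eq_continuous_at)
  have "continuous (at z within sphere 0 1) (\<lambda>z. D (Arg z))" if z: "z \<in> sphere 0 1" for z
  proof (cases "z \<in> \<real>\<^sub>\<le>\<^sub>0")
    case False
    then have "isCont (\<lambda>z. D (Arg z)) z"
      by (intro isCont_o2[OF continuous_at_Arg D])
    then show ?thesis by (rule continuous_at_imp_continuous_at_within)
  next
    case True
    then have "z \<notin> \<real>\<^sub>\<ge>\<^sub>0" using z by (auto simp: complex_nonpos_Reals_iff complex_nonneg_Reals_iff cmod_def)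
    then have "isCont (\<lambda>z. D (Arg2pi z)) z"
      by (intro isCont_o2[OF continuous_at_Arg2pi D])
    then have "continuous (at z within sphere 0 1) (\<lambda>z. D (Arg2pi z))"
      by (rule continuous_at_imp_continuous_at_within)
    then show ?thesis
      by (rule continuous_transform_within[where \<delta>=1]) (use z * in auto)
  qed
  then show "continuous_on (sphere 0 1) (\<lambda>z. D (Arg z))"
    by (simp add: continuous_on_eq_continuous_within)
qed

text \<open>
  If \<open>D\<close> is orthogonal to all trigonometric polynomials and such a polynomial approximates it
  uniformly, then the integral of the square of \<open>D\<close> is arbitrarily small.
\<close>
lemma periodic_eq_zero_if_fourier_coeffs_zero:
  fixes D :: "real \<Rightarrow> real"
  assumes cont: "continuous_on UNIV D" and per: "\<And>x. D (x + 2 * pi) = D x"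
    and coeff: "\<And>k::int. integral {0..2 * pi} (\<lambda>x. D x *\<^sub>R cis (of_int k * x)) = 0"
  shows "D x = 0"
proof -
  have contI: "continuous_on {0..2*pi} D" using cont continuous_on_subset by blast
  obtain M where M: "\<And>x. x \<in> {0..2 * pi} \<Longrightarrow> \<bar>D x\<bar> \<le> M"
    using compact_imp_bounded[OF compact_continuous_image[OF contI compact_Icc]]
    by (force simp: bounded_iff)
  have M0: "M \<ge> 0" using M[of 0] by auto
  have "integral {0..2 * pi} (\<lambda>x. D x * D x) = 0"
  proof (rule ccontr)
    define I where "I = integral {0..2 * pi} (\<lambda>x. D x * D x)"
    assume "integral {0..2 * pi} (\<lambda>x. D x * D x) \<noteq> 0"
    moreover have "I \<ge> 0" unfolding I_def by (rule Henstock_Kurzweil_Integration.integral_nonneg) (auto intro!: integrable_continuous_real continuous_intros contI)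
    ultimately have I: "I > 0" by (simp add: I_def)
    \<comment> \<open>Chosen so that an error of \<open>e\<close> in the approximation changes the integral by at most \<open>I / 2\<close>.\<close>
    define e where "e = I / (4 * pi) * (1 / (M + 1))"
    have e: "e > 0" using I M0 by (simp add: e_def)
    obtain p where p: "real_polynomial_function p" "\<And>z. z \<in> sphere 0 1 \<Longrightarrow> \<bar>D (Arg z) - p z\<bar> < e"
      using Stone_Weierstrass_real_polynomial_function[OF _ continuous_periodic_of_Arg(1)[OF cont per] e]
      by (metis compact_sphere)
    have near: "\<bar>D x - p (cis x)\<bar> \<le> e" for x
      using p(2)[of "cis x"] continuous_periodic_of_Arg(2)[OF cont per, of x] by simp
    have tp: "trig_poly (\<lambda>x. of_real (p (cis x)))" by (rule trig_poly_real_polynomial_cis) fact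
    have cp: "continuous_on {0..2*pi} (\<lambda>x. p (cis x))"
      using continuous_on_Re[OF trig_poly_continuous[OF tp]] by simp
    have "integral {0..2 * pi} (\<lambda>x. D x *\<^sub>R (of_real (p (cis x)) :: complex)) = 0"
      by (rule integral_trig_poly_zero[OF tp cont coeff])
    moreover have "(\<lambda>x. D x * p (cis x)) integrable_on {0..2 * pi}"
      by (intro integrable_continuous_real continuous_intros contI cp)
    ultimately have "of_real (integral {0..2 * pi} (\<lambda>x. D x * p (cis x))) = (0::complex)"
      using integral_linear[OF _ bounded_linear_of_real[where 'a=complex], of "\<lambda>x. D x * p (cis x)" "{0..2 * pi}"]
      by (simp add: o_def scaleR_conv_of_real)
    then have "I = integral {0..2 * pi} (\<lambda>x. D x * D x) - integral {0..2 * pi} (\<lambda>x. D x * p (cis x))"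
      by (simp add: I_def)
    also have "\<dots> = integral {0..2 * pi} (\<lambda>x. D x * (D x - p (cis x)))"
      by (subst integral_diff[symmetric]) (auto simp: right_diff_distrib intro!: integrable_continuous_real continuous_intros contI cp)
    also have "\<dots> \<le> integral {0..2 * pi} (\<lambda>x. M * e)"
    proof (rule integral_le)
      fix x assume "x \<in> {0..2*pi}"
      have "D x * (D x - p (cis x)) \<le> \<bar>D x\<bar> * \<bar>D x - p (cis x)\<bar>"
        by (metis abs_ge_self abs_mult)
      also have "\<dots> \<le> M * e" using M[OF \<open>x \<in> _\<close>] near e by (intro mult_mono) auto
      finally show "D x * (D x - p (cis x)) \<le> M * e" .
    qed (auto intro!: integrable_continuous_real continuous_intros contI cp)
    also have "\<dots> = I / 2 * (M / (M + 1))" using M0 by (simp add: e_def) (simp add: field_simps)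
    also have "\<dots> \<le> I / 2" using I M0 by (intro mult_left_le) auto
    finally show False using I by simp
  qed
  moreover have "continuous_on {0..2 * pi} (\<lambda>x. D x * D x)"
    by (intro continuous_intros contI)
  ultimately have "\<forall>x\<in>{0..2 * pi}. D x * D x = 0"
    by (subst (asm) integral_eq_0_iff) simp_all
  then have zero: "D x = 0" if "x \<in> {0..2*pi}" for x
    using that by simp
  \<comment> \<open>Outside of \<open>[0, 2 \<pi>]\<close> the value is that at the representative of \<open>x\<close> modulo \<open>2 \<pi>\<close>.\<close>
  define n where "n = \<lfloor>x / (2 * pi)\<rfloor>"
  define y where "y = x + of_int (- n) * (2 * pi)"
  have "y \<in> {0..2*pi}"
  proof -
    have "of_int n \<le> x / (2 * pi)" "x / (2 * pi) \<le> of_int n + 1" unfolding n_def by linarith+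
    then have "of_int n * (2 * pi) \<le> x" "x \<le> (of_int n + 1) * (2 * pi)"
      by (simp_all only: pos_le_divide_eq pos_divide_le_eq pi_gt_zero zero_less_numeral mult_pos_pos)
    then show ?thesis by (simp add: y_def algebra_simps)
  qed
  moreover have "D y = D x" unfolding y_def by (rule periodic_int_shift) (rule per)
  ultimately show ?thesis using zero by simp
qed

section \<open>Sums of Gaussians over arithmetic progressions\<close>

text \<open>
  The summand is decreasing, so the sum over \<open>1, \<dots>, N\<close> is at most the integral over \<open>[0, N]\<close>,
  hence at most the Gaussian integral over the half line.
\<close>
lemma sum_exp_neg_square_le:
  fixes s :: real
  assumes s: "s > 0"
  shows "(\<Sum>n<N. exp (- (s * (real n + 1))\<^sup>2)) \<le> sqrt pi / (2 * s)"
proof -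
  define f where "f = (\<lambda>x::real. exp (- (s * x)\<^sup>2))"
  interpret antimono_fun_sum_integral_diff f
  proof
    show "f y \<le> f x" if "0 \<le> x" "x \<le> y" for x y
      using that s by (auto simp: f_def intro!: power_mono mult_left_mono)
    show "continuous_on {0..} f" unfolding f_def by (intro continuous_intros)
  qed (simp add: f_def)
  have "has_bochner_integral lborel (\<lambda>x. indicator {0..} (0 + s * x) *\<^sub>R exp (- (0 + s * x)\<^sup>2)) ((sqrt pi / 2) /\<^sub>R \<bar>s\<bar>)"
    using gaussian_moment_0 s by (subst lborel_has_bochner_integral_real_affine_iff[symmetric]) auto
  moreover have "(\<lambda>x. indicator {0..} (0 + s * x) *\<^sub>R exp (- (0 + s * x)\<^sup>2)) = (\<lambda>x. indicator {0..} x * f x)"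
    using s by (auto simp: fun_eq_iff f_def indicator_def zero_le_mult_iff)
  moreover have "(sqrt pi / 2) /\<^sub>R \<bar>s\<bar> = sqrt pi / (2 * s)"
    using s by (simp add: field_simps)
  ultimately have int: "has_bochner_integral lborel (\<lambda>x. indicator {0..} x * f x) (sqrt pi / (2 * s))"
    by (simp only:)
  have si: "set_integrable lborel {0..real N} f"
    unfolding f_def by (intro borel_integrable_atLeastAtMost' continuous_intros)
  have "{..N} = insert 0 (Suc ` {..<N})"
    by (metis lessThan_Suc_atMost lessThan_Suc_eq_insert_0)
  then have "(\<Sum>n\<le>N. f (real n)) = f 0 + (\<Sum>n<N. f (real n + 1))"
    by (simp add: sum.reindex add_ac)
  moreover have "sum_integral_diff_series N \<le> sum_integral_diff_series 0"
    by (rule sum_integral_diff_series_antimono) simp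
  ultimately have "(\<Sum>n<N. f (real n + 1)) \<le> integral {0..real N} f"
    by (simp add: sum_integral_diff_series_def)
  also have "\<dots> = (LINT x:{0..real N}|lborel. f x)"
    using set_borel_integral_eq_integral(2)[OF si] by simp
  also have "\<dots> \<le> (LINT x|lborel. indicator {0..} x * f x)"
    unfolding set_lebesgue_integral_def
  proof (rule integral_mono)
    show "integrable lborel (\<lambda>x. indicat_real {0..real N} x *\<^sub>R f x)"
      using si by (simp add: set_integrable_def)
    show "integrable lborel (\<lambda>x. indicat_real {0..} x * f x)"
      using int by (rule integrable.intros)
  qed (auto simp: indicator_def f_def)
  also have "\<dots> = sqrt pi / (2 * s)"
    using int by (rule has_bochner_integral_integral_eq)
  finally show ?thesis by (simp add: f_def)
qed

lemma
  fixes s :: real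
  assumes s: "s > 0"
  shows summable_exp_neg_square: "summable (\<lambda>n. exp (- (s * (real n + 1))\<^sup>2))"
    and suminf_exp_neg_square_le: "(\<Sum>n. exp (- (s * (real n + 1))\<^sup>2)) \<le> sqrt pi / (2 * s)"
proof -
  show *: "summable (\<lambda>n. exp (- (s * (real n + 1))\<^sup>2))"
    by (rule bounded_imp_summable[where B = "sqrt pi / (2 * s)"])
       (use sum_exp_neg_square_le[OF s, of "Suc _"] in \<open>auto simp: lessThan_Suc_atMost\<close>)
  show "(\<Sum>n. exp (- (s * (real n + 1))\<^sup>2)) \<le> sqrt pi / (2 * s)"
    by (rule suminf_le_const[OF * sum_exp_neg_square_le[OF s]])
qed

text \<open>
  With \<open>(m + i)\<^sup>2 \<ge> m\<^sup>2 + 2 m i\<close> the tail is dominated by a geometric series of ratio \<open>exp (- b)\<close>, where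
  \<open>b = 2 s\<^sup>2 m\<close>, and \<open>exp (- b) / (1 - exp (- b)) = 1 / (exp b - 1) \<le> 1 / b\<close>.
\<close>
lemma suminf_exp_neg_square_tail_le:
  fixes s :: real
  assumes s: "s > 0" and m: "m \<ge> 1"
  shows "(\<Sum>n. exp (- (s * (real (n + m) + 1))\<^sup>2)) \<le> exp (- (s * real m)\<^sup>2) / (2 * s\<^sup>2 * real m)"
proof -
  define b where "b = 2 * s\<^sup>2 * real m"
  have b: "b > 0" using s m by (simp add: b_def)
  have summ: "summable (\<lambda>n. exp (- (s * (real (n + m) + 1))\<^sup>2))"
    using summable_exp_neg_square[OF s] by (subst summable_iff_shift)
  have summ2: "summable (\<lambda>n. exp (- b) ^ n)"
    using b by (intro summable_geometric) simp
  have term_le: "exp (- (s * (real (n + m) + 1))\<^sup>2) \<le> exp (- (s * real m)\<^sup>2) * exp (- b) * exp (- b) ^ n" for n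
  proof -
    have "(s * real m)\<^sup>2 + real (Suc n) * b \<le> (s * (real (n + m) + 1))\<^sup>2"
      using s by (simp add: b_def power2_eq_square algebra_simps)
    then have "exp (- (s * (real (n + m) + 1))\<^sup>2) \<le> exp (- (s * real m)\<^sup>2 + real (Suc n) * (- b))" by simp
    also have "\<dots> = exp (- (s * real m)\<^sup>2) * exp (- b) * exp (- b) ^ n"
      by (simp only: exp_add exp_of_nat_mult) simp
    finally show ?thesis .
  qed
  have "(\<Sum>n. exp (- (s * (real (n + m) + 1))\<^sup>2)) \<le> (\<Sum>n. exp (- (s * real m)\<^sup>2) * exp (- b) * exp (- b) ^ n)"
    by (intro suminf_le term_le summ summable_mult summ2)
  also have "\<dots> = exp (- (s * real m)\<^sup>2) * (exp (- b) / (1 - exp (- b)))"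
    using b by (subst suminf_mult[OF summ2]) (simp add: suminf_geometric)
  also have "exp (- b) / (1 - exp (- b)) = 1 / (exp b - 1)"
    using b by (simp add: exp_minus field_simps)
  also have "1 / (exp b - 1) \<le> 1 / b"
    using exp_ge_add_one_self[of b] b by (intro divide_left_mono mult_pos_pos) linarith+
  finally show ?thesis by (simp add: b_def)
qed

text \<open>
  The sum of a Gaussian of width \<open>\<tau>\<close> over the half lattice \<open>u, u + p, u + 2 p, \<dots>\<close>. The Gaussian is
  even, so its sum over the full lattice \<open>u + p \<int>\<close> is \<open>gauss_tail \<tau> p u + gauss_tail \<tau> p (p - u)\<close>, and
  series indexed by \<open>nat\<close> suffice.
\<close>
definition gauss_tail :: "real \<Rightarrow> real \<Rightarrow> real \<Rightarrow> real" where
  "gauss_tail \<tau> p u = (\<Sum>n. exp (- (u + p * real n)\<^sup>2 / (2 * \<tau>\<^sup>2)))"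

text \<open>
  A majorant that is geometric in \<open>n\<close> and uniform for bounded \<open>u\<close>. It comes from
  \<open>(u + v)\<^sup>2 \<ge> v\<^sup>2 / 2 - u\<^sup>2\<close>.
\<close>
lemma gauss_translate_le:
  fixes u :: real
  assumes "\<tau> > 0" "\<bar>u\<bar> \<le> R"
  shows "exp (- (u + p * real n)\<^sup>2 / (2 * \<tau>\<^sup>2)) \<le> exp (R\<^sup>2 / (2 * \<tau>\<^sup>2)) * exp (- p\<^sup>2 / (4 * \<tau>\<^sup>2)) ^ n"
proof -
  \<comment> \<open>The difference of the two sides is half of \<open>(2 u + p n)\<^sup>2\<close>.\<close>
  have "(p * real n)\<^sup>2 / 2 \<le> (u + p * real n)\<^sup>2 + u\<^sup>2"
    using zero_le_power2[of "2 * u + p * real n"] by (simp add: power2_eq_square algebra_simps)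
  moreover have "u\<^sup>2 \<le> R\<^sup>2" using assms by (metis abs_ge_zero power2_abs power_mono)
  moreover have "p\<^sup>2 * real n \<le> (p * real n)\<^sup>2"
    unfolding power_mult_distrib by (rule mult_left_mono) (auto simp: power2_eq_square simp flip: of_nat_mult)
  ultimately have "- (u + p * real n)\<^sup>2 \<le> R\<^sup>2 - p\<^sup>2 * real n / 2" by linarith
  then have "- (u + p * real n)\<^sup>2 / (2 * \<tau>\<^sup>2) \<le> (R\<^sup>2 - p\<^sup>2 * real n / 2) / (2 * \<tau>\<^sup>2)"
    by (rule divide_right_mono) simp
  also have "\<dots> = R\<^sup>2 / (2 * \<tau>\<^sup>2) + real n * (- p\<^sup>2 / (4 * \<tau>\<^sup>2))"
    using assms by (simp add: field_simps)
  finally have "exp (- (u + p * real n)\<^sup>2 / (2 * \<tau>\<^sup>2)) \<le> exp (R\<^sup>2 / (2 * \<tau>\<^sup>2) + real n * (- p\<^sup>2 / (4 * \<tau>\<^sup>2)))"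
    by simp
  then show ?thesis by (simp only: exp_add exp_of_nat_mult)
qed

lemma summable_gauss_majorant:
  assumes "\<tau> > 0" "p > 0"
  shows "summable (\<lambda>n. exp (R\<^sup>2 / (2 * \<tau>\<^sup>2)) * exp (- p\<^sup>2 / (4 * \<tau>\<^sup>2)) ^ n :: real)"
  using assms by (intro summable_mult summable_geometric) simp

lemma summable_gauss_tail:
  assumes "\<tau> > 0" "p > 0"
  shows "summable (\<lambda>n. exp (- (u + p * real n)\<^sup>2 / (2 * \<tau>\<^sup>2)))"
  by (rule summable_comparison_test'[OF summable_gauss_majorant[OF assms, of "\<bar>u\<bar>"]])
     (use gauss_translate_le[OF assms(1) order_refl] in auto)

lemma uniform_limit_gauss_tail:
  assumes "\<tau> > 0" "p > 0"
  shows "uniform_limit {-R..R} (\<lambda>N u. \<Sum>n<N. exp (- (u + p * real n)\<^sup>2 / (2 * \<tau>\<^sup>2))) (gauss_tail \<tau> p) sequentially"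
  unfolding gauss_tail_def
  by (rule Weierstrass_m_test[OF _ summable_gauss_majorant[OF assms, of R]])
     (use gauss_translate_le[OF assms(1), of _ R] in auto)

lemma continuous_on_UNIV_if_continuous_on_Icc:
  fixes f :: "real \<Rightarrow> real"
  assumes "\<And>R. continuous_on {-R..R} f"
  shows "continuous_on UNIV f"
proof -
  have "isCont f x" for x
    by (rule continuous_on_interior[OF assms[of "\<bar>x\<bar> + 1"]]) (auto simp: abs_if)
  then show ?thesis by (simp add: continuous_at_imp_continuous_on)
qed

lemma continuous_gauss_tail:
  assumes "\<tau> > 0" "p > 0"
  shows "continuous_on UNIV (gauss_tail \<tau> p)"
proof (rule continuous_on_UNIV_if_continuous_on_Icc)
  fix R
  show "continuous_on {-R..R} (gauss_tail \<tau> p)"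
    by (rule uniform_limit_theorem[OF _ uniform_limit_gauss_tail[OF assms]])
       (use assms in \<open>auto intro!: always_eventually continuous_intros\<close>)
qed

text \<open>
  Together with the evenness of the Gaussian this gives the periodicity of the sum over the full
  lattice; it also separates the term of the original kernel from its images.
\<close>
lemma gauss_tail_rec:
  assumes "\<tau> > 0" "p > 0"
  shows "gauss_tail \<tau> p u = exp (- u\<^sup>2 / (2 * \<tau>\<^sup>2)) + gauss_tail \<tau> p (u + p)"
proof -
  have "gauss_tail \<tau> p u - exp (- u\<^sup>2 / (2 * \<tau>\<^sup>2)) = (\<Sum>n. exp (- (u + p * real (Suc n))\<^sup>2 / (2 * \<tau>\<^sup>2)))"
    unfolding gauss_tail_def using suminf_split_head[OF summable_gauss_tail[OF assms, of u]] by simp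
  also have "\<dots> = gauss_tail \<tau> p (u + p)"
    by (simp add: gauss_tail_def algebra_simps)
  finally show ?thesis by simp
qed

lemma gauss_tail_nonneg: "\<tau> > 0 \<Longrightarrow> p > 0 \<Longrightarrow> gauss_tail \<tau> p u \<ge> 0"
  unfolding gauss_tail_def by (intro suminf_nonneg summable_gauss_tail) auto

text \<open>
  For nonnegative \<open>u\<close> one has \<open>(u + p n)\<^sup>2 \<ge> \<delta>\<^sup>2 + (p n)\<^sup>2\<close>. The terms with \<open>n \<ge> 1\<close> are then bounded by
  the Gaussian integral.
\<close>
lemma gauss_tail_le:
  assumes l: "l > 0" and p: "p > 0" and \<delta>: "0 \<le> \<delta>" "\<delta> \<le> u"
  shows "gauss_tail l p u \<le> exp (- \<delta>\<^sup>2 / (2 * l\<^sup>2)) * (1 + sqrt (2 * pi) * l / (2 * p))"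
proof -
  define s where "s = p / (sqrt 2 * l)"
  have s: "s > 0" using l p by (simp add: s_def)
  have "(s * real n)\<^sup>2 = (p * real n)\<^sup>2 / (2 * l\<^sup>2)" for n
    by (simp add: s_def power_mult_distrib power_divide)
  then have term_le: "exp (- (u + p * real n)\<^sup>2 / (2 * l\<^sup>2)) \<le> exp (- \<delta>\<^sup>2 / (2 * l\<^sup>2)) * exp (- (s * real n)\<^sup>2)" for n
  proof -
    have "\<delta>\<^sup>2 \<le> u\<^sup>2" using \<delta> by (intro power_mono) auto
    moreover have "0 \<le> u * (p * real n)" using \<delta> p by simp
    ultimately have "- (u + p * real n)\<^sup>2 \<le> - \<delta>\<^sup>2 - (p * real n)\<^sup>2"
      unfolding power2_sum by linarith
    then have "- (u + p * real n)\<^sup>2 / (2 * l\<^sup>2) \<le> (- \<delta>\<^sup>2 - (p * real n)\<^sup>2) / (2 * l\<^sup>2)"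
      by (rule divide_right_mono) simp
    also have "\<dots> = - \<delta>\<^sup>2 / (2 * l\<^sup>2) + - (s * real n)\<^sup>2"
      using \<open>\<And>n. (s * real n)\<^sup>2 = _\<close> by (simp add: diff_divide_distrib)
    finally show ?thesis by (simp only: exp_add[symmetric] exp_le_cancel_iff)
  qed
  have summ: "summable (\<lambda>n. exp (- (s * real n)\<^sup>2))"
    using summable_exp_neg_square[OF s] by (subst summable_Suc_iff[symmetric]) (simp add: add_ac)
  have "gauss_tail l p u \<le> (\<Sum>n. exp (- \<delta>\<^sup>2 / (2 * l\<^sup>2)) * exp (- (s * real n)\<^sup>2))"
    unfolding gauss_tail_def by (intro suminf_le term_le summable_gauss_tail l p summable_mult summ)
  also have "\<dots> = exp (- \<delta>\<^sup>2 / (2 * l\<^sup>2)) * (\<Sum>n. exp (- (s * real n)\<^sup>2))"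
    by (rule suminf_mult[OF summ])
  also have "(\<Sum>n. exp (- (s * real n)\<^sup>2)) = 1 + (\<Sum>n. exp (- (s * (real n + 1))\<^sup>2))"
    using suminf_split_head[OF summ] by (simp add: add_ac)
  also have "(\<Sum>n. exp (- (s * (real n + 1))\<^sup>2)) \<le> sqrt pi / (2 * s)"
    by (rule suminf_exp_neg_square_le[OF s])
  also have "sqrt pi / (2 * s) = sqrt (2 * pi) * l / (2 * p)"
    using l p by (simp add: s_def real_sqrt_mult field_simps)
  finally show ?thesis by simp
qed

section \<open>Poisson summation for the Gaussian\<close>

lemma has_integral_cis:
  "((\<lambda>x. cis (of_int k * x)) has_integral (if k = 0 then 2 * pi else 0)) {0..2 * pi}"
proof (cases "k = 0")
  case True
  then show ?thesis using has_integral_const_real[of "1::complex" 0 "2*pi"] by (simp add: scaleR_conv_of_real)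
next
  case False
  define F where "F = (\<lambda>x. exp (\<i> * of_int k * of_real x) / (\<i> * of_int k))"
  have "((\<lambda>x. exp (\<i> * of_int k * of_real x)) has_integral F (2 * pi) - F 0) {0..2 * pi}"
    unfolding F_def using False
    by (intro fundamental_theorem_of_calculus)
       (auto intro!: derivative_eq_intros has_vector_derivative_real_field)
  moreover have "exp (\<i> * of_int k * of_real (2 * pi)) = 1"
    by (rule exp_integer_2pi[THEN trans[rotated]]) (auto simp: algebra_simps)
  ultimately show ?thesis using False by (simp add: F_def cis_conv_exp mult_ac)
qed

lemma has_integral_cos_cis:
  "((\<lambda>x. cos ((real n + 1) * x) *\<^sub>R cis (of_int k * x)) has_integral (if int n + 1 = \<bar>k\<bar> then pi else 0)) {0..2 * pi}"
proof -
  define m where "m = int n + 1"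
  have m: "real n + 1 = of_int m" "m > 0" by (auto simp: m_def)
  have "cos (of_int m * x) *\<^sub>R cis (of_int k * x) = (1/2) *\<^sub>R cis (of_int (k + m) * x) + (1/2) *\<^sub>R cis (of_int (k - m) * x)" for x
    by (simp add: complex_eq_iff cos_add cos_diff sin_add sin_diff distrib_right left_diff_distrib add_divide_distrib diff_divide_distrib)
  moreover have "((\<lambda>x. (1/2) *\<^sub>R cis (of_int (k + m) * x) + (1/2) *\<^sub>R cis (of_int (k - m) * x))
     has_integral ((1/2) *\<^sub>R of_real (if k + m = 0 then 2 * pi else 0) + (1/2) *\<^sub>R of_real (if k - m = 0 then 2 * pi else 0))) {0..2 * pi}"
    by (intro has_integral_add has_integral_cmul has_integral_cis)
  moreover have "(1/2) *\<^sub>R of_real (if k + m = 0 then 2 * pi else 0) + (1/2) *\<^sub>R of_real (if k - m = 0 then 2 * pi else 0)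
      = (of_real (if m = \<bar>k\<bar> then pi else 0) :: complex)"
    using m(2) by (auto simp: complex_eq_iff)
  ultimately show ?thesis by (simp add: m m_def[symmetric])
qed

lemma gauss_fourier:
  fixes \<tau> w :: real
  assumes \<tau>: "\<tau> > 0"
  shows "integrable lborel (\<lambda>x. exp (- x\<^sup>2 / (2 * \<tau>\<^sup>2)) *\<^sub>R cis (w * x))"
    and "(LINT x|lborel. exp (- x\<^sup>2 / (2 * \<tau>\<^sup>2)) *\<^sub>R cis (w * x)) = of_real (sqrt (2 * pi) * \<tau> * exp (- \<tau>\<^sup>2 * w\<^sup>2 / 2))"
proof -
  have eq: "(\<lambda>x. complex_of_real (exp (- x\<^sup>2 / (2 * \<tau>\<^sup>2))) * exp (- (\<i> * complex_of_real ((- w) * x))))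
      = (\<lambda>x. exp (- x\<^sup>2 / (2 * \<tau>\<^sup>2)) *\<^sub>R cis (w * x))"
    by (simp add: fun_eq_iff scaleR_conv_of_real cis_conv_exp)
  show "integrable lborel (\<lambda>x. exp (- x\<^sup>2 / (2 * \<tau>\<^sup>2)) *\<^sub>R cis (w * x))"
    using gaussian_fourier_real(1)[OF \<tau>, of "- w"] unfolding eq .
  show "(LINT x|lborel. exp (- x\<^sup>2 / (2 * \<tau>\<^sup>2)) *\<^sub>R cis (w * x)) = of_real (sqrt (2 * pi) * \<tau> * exp (- \<tau>\<^sup>2 * w\<^sup>2 / 2))"
    using gaussian_fourier_real(2)[OF \<tau>, of "- w"] unfolding eq by simp
qed

text \<open>
  Against a \<open>2 \<pi>\<close>-periodic function, the translates of the Gaussian by \<open>2 \<pi> n\<close> restricted to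
  one period piece together to the Gaussian on a long symmetric interval. Working with partial sums
  leaves a single passage to the limit.
\<close>
lemma integral_gauss_periodized:
  fixes k :: int
  assumes \<tau>: "\<tau> > 0"
  defines "g \<equiv> \<lambda>x::real. exp (- x\<^sup>2 / (2 * \<tau>\<^sup>2))"
  shows "integral {0..2 * pi} (\<lambda>u. ((\<Sum>n<N. g (u + 2 * pi * real n)) + (\<Sum>n<N. g (2 * pi - u + 2 * pi * real n))) *\<^sub>R cis (of_int k * u))
    = integral {- (2 * pi * real N)..2 * pi * real N} (\<lambda>x. g x *\<^sub>R cis (of_int k * x))"
proof (induction N)
  case 0
  then show ?case by simp
next
  case (Suc N)
  define h where "h = (\<lambda>x. g x *\<^sub>R cis (of_int k * x))"
  have contg: "continuous_on A (\<lambda>x. g (f x))" if "continuous_on A f" for A and f :: "real \<Rightarrow> real"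
    unfolding g_def using \<tau> that by (intro continuous_intros) auto
  have conth: "continuous_on A (\<lambda>x. h (f x))" if "continuous_on A f" for A and f :: "real \<Rightarrow> real"
    unfolding h_def using that by (intro continuous_intros contg)
  have int: "h integrable_on {a..b}" for a b
    using conth[of "{a..b}" "\<lambda>x. x"] by (intro integrable_continuous_real) simp
  have periodic: "cis (of_int k * (u + 2 * pi * of_int j)) = cis (of_int k * u)" for u j
  proof -
    have "of_int k * (u + 2 * pi * of_int j) = of_int k * u + 2 * pi * of_int (k * j)"
      by (simp add: algebra_simps)
    then show ?thesis by (simp only: cis_mult[symmetric] cis_multiple_2pi[OF Ints_of_int] mult_1_right)
  qed
  have right: "g (u + 2 * pi * real N) *\<^sub>R cis (of_int k * u) = h (u + 2 * pi * real N)" for u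
    unfolding h_def using periodic[of u "int N"] by simp
  have left: "g (2 * pi - u + 2 * pi * real N) *\<^sub>R cis (of_int k * u) = h (u - 2 * pi * real (Suc N))" for u
  proof -
    have "g (2 * pi - u + 2 * pi * real N) = g (u - 2 * pi * real (Suc N))"
      unfolding g_def by (subst power2_commute[of u]) (simp add: algebra_simps)
    moreover have "u + 2 * pi * of_int (- int (Suc N)) = u - 2 * pi * real (Suc N)" by (simp add: algebra_simps)
    ultimately show ?thesis unfolding h_def using periodic[of u "- int (Suc N)"] by (simp only:)
  qed
  let ?S = "\<lambda>u. (\<Sum>n<N. g (u + 2 * pi * real n)) + (\<Sum>n<N. g (2 * pi - u + 2 * pi * real n))"
  have "integral {0..2 * pi} (\<lambda>u. ((\<Sum>n<Suc N. g (u + 2 * pi * real n)) + (\<Sum>n<Suc N. g (2 * pi - u + 2 * pi * real n))) *\<^sub>R cis (of_int k * u))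
    = integral {0..2 * pi} (\<lambda>u. ?S u *\<^sub>R cis (of_int k * u) + (h (u + 2 * pi * real N) + h (u - 2 * pi * real (Suc N))))"
    unfolding right[symmetric] left[symmetric] by (simp add: algebra_simps)
  also have "\<dots> = integral {0..2 * pi} (\<lambda>u. ?S u *\<^sub>R cis (of_int k * u))
     + (integral {0..2 * pi} (\<lambda>u. h (u + 2 * pi * real N)) + integral {0..2 * pi} (\<lambda>u. h (u - 2 * pi * real (Suc N))))"
    by (subst integral_add, (intro integrable_continuous_real continuous_intros contg conth)+)+ simp
  also have "integral {0..2 * pi} (\<lambda>u. h (u + 2 * pi * real N)) = integral {2 * pi * real N..2 * pi * real (Suc N)} h"
    using integral_shift_Icc_real[of 0 "2 * pi" h "2 * pi * real N"] by (simp add: o_def add_ac algebra_simps)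
  also have "integral {0..2 * pi} (\<lambda>u. h (u - 2 * pi * real (Suc N))) = integral {- (2 * pi * real (Suc N))..- (2 * pi * real N)} h"
    using integral_shift_Icc_real[of 0 "2 * pi" h "- (2 * pi * real (Suc N))"] by (simp add: o_def algebra_simps)
  also have "integral {0..2 * pi} (\<lambda>u. ?S u *\<^sub>R cis (of_int k * u)) + (integral {2 * pi * real N..2 * pi * real (Suc N)} h + integral {- (2 * pi * real (Suc N))..- (2 * pi * real N)} h)
    = integral {- (2 * pi * real (Suc N))..2 * pi * real (Suc N)} h"
  proof -
    have "0 \<le> 2 * pi * real N" "0 \<le> 2 * pi" by simp_all
    moreover have "2 * pi * real (Suc N) = 2 * pi * real N + 2 * pi" by (simp add: algebra_simps)
    ultimately have le: "- (2 * pi * real (Suc N)) \<le> - (2 * pi * real N)" "- (2 * pi * real N) \<le> 2 * pi * real N"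
       "- (2 * pi * real (Suc N)) \<le> 2 * pi * real N" "2 * pi * real N \<le> 2 * pi * real (Suc N)"
      by linarith+
    have 1: "integral {- (2 * pi * real (Suc N))..- (2 * pi * real N)} h + integral {- (2 * pi * real N)..2 * pi * real N} h = integral {- (2 * pi * real (Suc N))..2 * pi * real N} h"
      by (rule Henstock_Kurzweil_Integration.integral_combine[OF le(1,2) int])
    have 2: "integral {- (2 * pi * real (Suc N))..2 * pi * real N} h + integral {2 * pi * real N..2 * pi * real (Suc N)} h = integral {- (2 * pi * real (Suc N))..2 * pi * real (Suc N)} h"
      by (rule Henstock_Kurzweil_Integration.integral_combine[OF le(3,4) int])
    show ?thesis using Suc.IH unfolding h_def[symmetric] 2[symmetric] 1[symmetric] by (simp add: add_ac)
  qed
  finally show ?case by (simp only: h_def)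
qed

lemma integral_symmetric_Icc_tendsto:
  fixes f :: "real \<Rightarrow> complex"
  assumes f: "integrable lborel f" and a: "filterlim a at_top sequentially"
  shows "(\<lambda>N. integral {- a N..a N} f) \<longlonglongrightarrow> (LINT x|lborel. f x)"
proof -
  have si: "set_integrable lborel {- a N..a N} f" for N
    using f unfolding set_integrable_def by (intro integrable_mult_indicator) auto
  have "(\<lambda>N. LINT x|lborel. indicator {- a N..a N} x *\<^sub>R f x) \<longlonglongrightarrow> (LINT x|lborel. f x)"
  proof (rule integral_dominated_convergence[where w = "\<lambda>x. norm (f x)"])
    show "AE x in lborel. (\<lambda>N. indicator {- a N..a N} x *\<^sub>R f x) \<longlonglongrightarrow> f x"
    proof (rule AE_I2)
      fix x :: real
      have "eventually (\<lambda>N. \<bar>x\<bar> \<le> a N) sequentially"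
        using a by (simp add: filterlim_at_top)
      then have "eventually (\<lambda>N. indicator {- a N..a N} x *\<^sub>R f x = f x) sequentially"
        by eventually_elim (auto simp: indicator_def)
      then show "(\<lambda>N. indicator {- a N..a N} x *\<^sub>R f x) \<longlonglongrightarrow> f x"
        by (rule tendsto_eventually)
    qed
  qed (use f in \<open>auto simp: indicator_def\<close>)
  also have "(\<lambda>N. LINT x|lborel. indicator {- a N..a N} x *\<^sub>R f x) = (\<lambda>N. integral {- a N..a N} f)"
    using set_borel_integral_eq_integral(2)[OF si] by (simp add: set_lebesgue_integral_def)
  finally show ?thesis .
qed

lemma integral_cosine_sum_tendsto:
  fixes k :: int
  shows "(\<lambda>N. integral {0..2 * pi} (\<lambda>u. (1 + 2 * (\<Sum>n<N. c (Suc n) * cos ((real n + 1) * u))) *\<^sub>R cis (of_int k * u)))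
    \<longlonglongrightarrow> of_real (if k = 0 then 2 * pi else 2 * pi * c (nat \<bar>k\<bar>))"
proof (rule tendsto_eventually)
  have "integral {0..2 * pi} (\<lambda>u. (1 + 2 * (\<Sum>n<N. c (Suc n) * cos ((real n + 1) * u))) *\<^sub>R cis (of_int k * u))
    = of_real (if k = 0 then 2 * pi else 2 * pi * c (nat \<bar>k\<bar>))" if N: "nat \<bar>k\<bar> < N" for N
  proof -
    have "((\<lambda>u. cis (of_int k * u) + (\<Sum>n<N. (2 * c (Suc n)) *\<^sub>R (cos ((real n + 1) * u) *\<^sub>R cis (of_int k * u))))
      has_integral (of_real (if k = 0 then 2 * pi else 0) + (\<Sum>n<N. (2 * c (Suc n)) *\<^sub>R of_real (if int n + 1 = \<bar>k\<bar> then pi else 0)))) {0..2 * pi}"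
      by (intro has_integral_add has_integral_sum has_integral_cmul has_integral_cis has_integral_cos_cis) auto
    also have "(\<lambda>u. cis (of_int k * u) + (\<Sum>n<N. (2 * c (Suc n)) *\<^sub>R (cos ((real n + 1) * u) *\<^sub>R cis (of_int k * u))))
      = (\<lambda>u. (1 + 2 * (\<Sum>n<N. c (Suc n) * cos ((real n + 1) * u))) *\<^sub>R cis (of_int k * u))"
      by (simp add: fun_eq_iff scaleR_add_left scaleR_sum_left[symmetric] sum_distrib_left mult.assoc)
    also have "of_real (if k = 0 then 2 * pi else 0) + (\<Sum>n<N. (2 * c (Suc n)) *\<^sub>R of_real (if int n + 1 = \<bar>k\<bar> then pi else 0))
      = (of_real ((if k = 0 then 2 * pi else 0) + (\<Sum>n<N. 2 * c (Suc n) * (if int n + 1 = \<bar>k\<bar> then pi else 0))) :: complex)"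
      by (simp only: of_real_add of_real_sum of_real_mult scaleR_conv_of_real)
    also have "(if k = 0 then 2 * pi else 0) + (\<Sum>n<N. 2 * c (Suc n) * (if int n + 1 = \<bar>k\<bar> then pi else 0))
      = (if k = 0 then 2 * pi else 2 * pi * c (nat \<bar>k\<bar>))"
    proof (cases "k = 0")
      case False
      have "(\<Sum>n<N. 2 * c (Suc n) * (if int n + 1 = \<bar>k\<bar> then pi else 0)) = (\<Sum>n<N. if n = nat \<bar>k\<bar> - 1 then 2 * c (Suc n) * pi else 0)"
        using False by (intro sum.cong) auto
      also have "\<dots> = 2 * pi * c (nat \<bar>k\<bar>)" using False N by (simp add: Suc_pred')
      finally show ?thesis using False by simp
    qed simp
    finally show ?thesis by (rule integral_unique)
  qed
  then show "\<forall>\<^sub>F N in sequentially. integral {0..2 * pi} (\<lambda>u. (1 + 2 * (\<Sum>n<N. c (Suc n) * cos ((real n + 1) * u))) *\<^sub>R cis (of_int k * u))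
    = of_real (if k = 0 then 2 * pi else 2 * pi * c (nat \<bar>k\<bar>))"
    by (auto simp: eventually_sequentially intro!: exI[of _ "Suc (nat \<bar>k\<bar>)"])
qed

text \<open>
  The functional equation of the theta function, that is, Poisson summation for the Gaussian. Both
  sides are continuous and \<open>2 \<pi>\<close>-periodic, and the partial sums converge uniformly. By
  \<open>integral_gauss_periodized\<close>, the Fourier coefficients of the left side are values of the Fourier transform of the Gaussian, and these
  are the coefficients on the right.
\<close>
lemma gauss_periodized_eq_theta:
  fixes \<tau> u :: real
  assumes \<tau>: "\<tau> > 0"
  shows "gauss_tail \<tau> (2 * pi) u + gauss_tail \<tau> (2 * pi) (2 * pi - u)
    = \<tau> / sqrt (2 * pi) * (1 + 2 * (\<Sum>n. exp (- (\<tau> / sqrt 2 * (real n + 1))\<^sup>2) * cos ((real n + 1) * u)))"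
proof -
  define c where "c = (\<lambda>n::nat. exp (- (\<tau> / sqrt 2 * real n)\<^sup>2))"
  define g where "g = (\<lambda>x::real. exp (- x\<^sup>2 / (2 * \<tau>\<^sup>2)))"
  define a where "a = \<tau> / sqrt (2 * pi)"
  define S where "S = (\<lambda>N u. (\<Sum>n<N. g (u + 2 * pi * real n)) + (\<Sum>n<N. g (2 * pi - u + 2 * pi * real n)))"
  define C where "C = (\<lambda>N u. 1 + 2 * (\<Sum>n<N. c (Suc n) * cos ((real n + 1) * u)))"
  define G where "G = (\<lambda>u. gauss_tail \<tau> (2 * pi) u + gauss_tail \<tau> (2 * pi) (2 * pi - u))"
  define T where "T = (\<lambda>u. 1 + 2 * (\<Sum>n. c (Suc n) * cos ((real n + 1) * u)))"
  define D where "D = (\<lambda>u. G u - a * T u)"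
  have sc: "summable (\<lambda>n. c (Suc n))"
    unfolding c_def using summable_exp_neg_square[of "\<tau> / sqrt 2"] \<tau> by (simp add: add_ac)
  have uC: "uniform_limit A C T sequentially" for A
    unfolding C_def T_def
    by (intro uniform_limit_intros Weierstrass_m_test[OF _ sc]) (auto simp: c_def abs_mult mult_left_le)
  have uS: "uniform_limit {0..2 * pi} S G sequentially"
  proof -
    have *: "uniform_limit {0..2 * pi} (\<lambda>N u. \<Sum>n<N. g (u + 2 * pi * real n)) (gauss_tail \<tau> (2 * pi)) sequentially"
      unfolding g_def by (rule uniform_limit_on_subset[OF uniform_limit_gauss_tail[OF \<tau>, of "2 * pi" "2 * pi"]]) auto
    have "uniform_limit {0..2 * pi} (\<lambda>N u. \<Sum>n<N. g ((2 * pi - u) + 2 * pi * real n)) (\<lambda>u. gauss_tail \<tau> (2 * pi) (2 * pi - u)) sequentially"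
      by (rule uniform_limit_compose'[OF *]) auto
    with * show ?thesis unfolding S_def G_def by (rule uniform_limit_add)
  qed
  have contG: "continuous_on UNIV G"
    unfolding G_def using continuous_gauss_tail[OF \<tau>, of "2*pi"]
    by (auto intro!: continuous_intros intro: continuous_on_compose2)
  have contC: "continuous_on A (C N)" for A N
    unfolding C_def by (intro continuous_intros)
  have contS: "continuous_on A (S N)" for A N
    unfolding S_def g_def using \<tau> by (intro continuous_intros) auto
  have contT: "continuous_on UNIV T"
    by (rule uniform_limit_theorem[OF _ uC]) (auto intro: always_eventually contC)
  have contD: "continuous_on UNIV D"
    unfolding D_def by (intro continuous_intros contG contT)
  have perD: "D (u + 2 * pi) = D u" for u
  proof -
    have "G (u + 2 * pi) = G u"
      using gauss_tail_rec[OF \<tau>, of "2 * pi" u] gauss_tail_rec[OF \<tau>, of "2 * pi" "- u"]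
      by (simp add: G_def add_ac)
    moreover have "cos ((real n + 1) * (u + 2 * pi)) = cos ((real n + 1) * u)" for n
    proof -
      have "(real n + 1) * (u + 2 * pi) = (real n + 1) * u + 2 * real (Suc n) * pi" by (simp add: algebra_simps)
      then show ?thesis by (simp only: cos_add cos_2npi sin_2npi mult_1_right mult_zero_right diff_zero)
    qed
    ultimately show ?thesis by (simp add: D_def T_def)
  qed
  have "D u = 0"
  proof (rule periodic_eq_zero_if_fourier_coeffs_zero[OF contD perD])
    fix k :: int
    let ?e = "\<lambda>x. cis (of_int k * x)"
    have int: "(\<lambda>x. S N x *\<^sub>R ?e x) integrable_on {0..2 * pi}" "(\<lambda>x. C N x *\<^sub>R ?e x) integrable_on {0..2 * pi}" for N
      by (intro integrable_continuous_real continuous_intros contS contC)+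
    have uD: "uniform_limit {0..2 * pi} (\<lambda>N x. (S N x - a * C N x) *\<^sub>R ?e x) (\<lambda>x. D x *\<^sub>R ?e x) sequentially"
    proof (rule uniform_limitI)
      fix e :: real assume "e > 0"
      have "uniform_limit {0..2 * pi} (\<lambda>N x. S N x - a * C N x) D sequentially"
        unfolding D_def by (intro uniform_limit_intros uS uC)
      from uniform_limitD[OF this \<open>e > 0\<close>]
      show "\<forall>\<^sub>F N in sequentially. \<forall>x\<in>{0..2 * pi}. dist ((S N x - a * C N x) *\<^sub>R ?e x) (D x *\<^sub>R ?e x) < e"
        by (simp add: dist_norm flip: scaleR_diff_left)
    qed
    have cont: "continuous_on {0..2 * pi} (\<lambda>x. (S N x - a * C N x) *\<^sub>R ?e x)" for N
      by (intro continuous_intros contS contC)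
    have lim: "(\<lambda>N. integral {0..2 * pi} (\<lambda>x. (S N x - a * C N x) *\<^sub>R ?e x)) \<longlonglongrightarrow> integral {0..2 * pi} (\<lambda>x. D x *\<^sub>R ?e x)"
    proof (rule uniform_limit_integral[OF uD cont sequentially_bot])
      fix I J assume I: "\<And>N. ((\<lambda>x. (S N x - a * C N x) *\<^sub>R ?e x) has_integral I N) {0..2 * pi}"
        and J: "((\<lambda>x. D x *\<^sub>R ?e x) has_integral J) {0..2 * pi}" and "I \<longlonglongrightarrow> J"
      then show ?thesis by (simp only: integral_unique[OF I] integral_unique[OF J])
    qed
    have top: "filterlim (\<lambda>N. 2 * pi * real N) at_top sequentially"
      by (rule filterlim_tendsto_pos_mult_at_top[OF tendsto_const]) (auto simp: filterlim_real_sequentially)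
    have "(\<lambda>N. integral {0..2 * pi} (\<lambda>x. S N x *\<^sub>R ?e x)) \<longlonglongrightarrow> of_real (sqrt (2 * pi) * \<tau> * exp (- \<tau>\<^sup>2 * (of_int k)\<^sup>2 / 2))"
      unfolding S_def g_def integral_gauss_periodized[OF \<tau>] gauss_fourier(2)[OF \<tau>, symmetric]
      by (rule integral_symmetric_Icc_tendsto[OF gauss_fourier(1)[OF \<tau>] top])
    moreover have "(\<lambda>N. integral {0..2 * pi} (\<lambda>x. C N x *\<^sub>R ?e x)) \<longlonglongrightarrow> of_real (if k = 0 then 2 * pi else 2 * pi * c (nat \<bar>k\<bar>))"
      unfolding C_def by (rule integral_cosine_sum_tendsto)
    ultimately have "(\<lambda>N. integral {0..2 * pi} (\<lambda>x. S N x *\<^sub>R ?e x) - a *\<^sub>R integral {0..2 * pi} (\<lambda>x. C N x *\<^sub>R ?e x)) \<longlonglongrightarrow>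
       of_real (sqrt (2 * pi) * \<tau> * exp (- \<tau>\<^sup>2 * (of_int k)\<^sup>2 / 2)) - a *\<^sub>R of_real (if k = 0 then 2 * pi else 2 * pi * c (nat \<bar>k\<bar>))"
      by (intro tendsto_intros)
    also have "(\<lambda>N. integral {0..2 * pi} (\<lambda>x. S N x *\<^sub>R ?e x) - a *\<^sub>R integral {0..2 * pi} (\<lambda>x. C N x *\<^sub>R ?e x)) =
       (\<lambda>N. integral {0..2 * pi} (\<lambda>x. (S N x - a * C N x) *\<^sub>R ?e x))"
      using int by (simp add: scaleR_diff_left integral_diff integrable_cmul flip: scaleR_scaleR integral_cmul)
    also have "of_real (sqrt (2 * pi) * \<tau> * exp (- \<tau>\<^sup>2 * (of_int k)\<^sup>2 / 2)) - a *\<^sub>R of_real (if k = 0 then 2 * pi else 2 * pi * c (nat \<bar>k\<bar>)) = (0::complex)"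
    proof -
      have "a * (2 * pi) = sqrt (2 * pi) * \<tau>"
        by (simp add: a_def field_simps real_sqrt_mult)
      moreover have "exp (- \<tau>\<^sup>2 * (of_int k)\<^sup>2 / 2) = c (nat \<bar>k\<bar>)"
        by (simp add: c_def power_mult_distrib power_divide)
      moreover have "c 0 = 1" by (simp add: c_def)
      ultimately show ?thesis by (cases "k = 0") (simp_all add: scaleR_conv_of_real flip: of_real_mult)
    qed
    finally show "integral {0..2 * pi} (\<lambda>x. D x *\<^sub>R ?e x) = 0"
      using lim LIMSEQ_unique by blast
  qed
  then show ?thesis
    by (simp add: D_def G_def T_def a_def c_def add_ac)
qed

lemma gauss_tail_rescale:
  assumes "r \<noteq> 0"
  shows "gauss_tail (r * \<tau>) (r * p) (r * u) = gauss_tail \<tau> p u"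
proof -
  have "- (r * u + r * p * real n)\<^sup>2 / (2 * (r * \<tau>)\<^sup>2) = - (u + p * real n)\<^sup>2 / (2 * \<tau>\<^sup>2)" for n
  proof -
    have "- (r * u + r * p * real n)\<^sup>2 / (2 * (r * \<tau>)\<^sup>2) = (r\<^sup>2 * - (u + p * real n)\<^sup>2) / (r\<^sup>2 * (2 * \<tau>\<^sup>2))"
      by (simp add: power2_eq_square algebra_simps)
    also have "\<dots> = - (u + p * real n)\<^sup>2 / (2 * \<tau>\<^sup>2)"
      using assms by (intro mult_divide_mult_cancel_left) simp
    finally show ?thesis .
  qed
  then show ?thesis by (simp only: gauss_tail_def)
qed

lemma gauss_periodized_eq_cosine_series:
  fixes l p u :: real
  assumes l: "l > 0" and p: "p > 0"
  shows "gauss_tail l p u + gauss_tail l p (p - u)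
    = sqrt (2 * pi) * l / p
      * (1 + 2 * (\<Sum>n. exp (- (sqrt 2 * pi * l / p * (real n + 1))\<^sup>2) * cos (2 * pi * (real n + 1) / p * u)))"
proof -
  define r where "r = 2 * pi / p"
  have r: "r > 0" "r * p = 2 * pi" using p by (simp_all add: r_def)
  have "gauss_tail l p u + gauss_tail l p (p - u)
    = gauss_tail (r * l) (2 * pi) (r * u) + gauss_tail (r * l) (2 * pi) (2 * pi - r * u)"
    using gauss_tail_rescale[of r l p u] gauss_tail_rescale[of r l p "p - u"] r
    by (simp add: right_diff_distrib)
  also have "\<dots> = r * l / sqrt (2 * pi) * (1 + 2 * (\<Sum>n. exp (- (r * l / sqrt 2 * (real n + 1))\<^sup>2) * cos ((real n + 1) * (r * u))))"
    using r l by (intro gauss_periodized_eq_theta) simp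
  also have "r * l / sqrt (2 * pi) = sqrt (2 * pi) * l / p"
  proof -
    have "r * l / sqrt (2 * pi) = (2 * pi / sqrt (2 * pi)) * l / p" by (simp add: r_def)
    also have "2 * pi / sqrt (2 * pi) = sqrt (2 * pi)" by (rule real_div_sqrt) simp
    finally show ?thesis .
  qed
  also have "r * l / sqrt 2 = sqrt 2 * pi * l / p"
  proof -
    have "r * l / sqrt 2 = (2 / sqrt 2) * pi * l / p" by (simp add: r_def)
    also have "2 / sqrt 2 = sqrt 2" by (rule real_div_sqrt) simp
    finally show ?thesis .
  qed
  also have "(\<lambda>n. exp (- (sqrt 2 * pi * l / p * (real n + 1))\<^sup>2) * cos ((real n + 1) * (r * u)))
    = (\<lambda>n. exp (- (sqrt 2 * pi * l / p * (real n + 1))\<^sup>2) * cos (2 * pi * (real n + 1) / p * u))"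
    by (simp add: r_def mult_ac)
  finally show ?thesis .
qed

section \<open>The sine series in one dimension\<close>

text \<open>
  The contribution of one coordinate with index \<open>n\<close>: the spectral density in dimension one at
  frequency \<open>\<pi> n / (2 L)\<close>, up to \<open>\<sigma>\<^sup>2\<close>, times the two sine factors and the normalisation \<open>1 / L\<close>.
\<close>
definition sine_term :: "real \<Rightarrow> real \<Rightarrow> real \<Rightarrow> real \<Rightarrow> nat \<Rightarrow> real" where
  "sine_term l L x t n = sqrt (2 * pi) * l / L * exp (- l\<^sup>2 * (pi * real n / (2 * L))\<^sup>2 / 2)
     * sin (pi * real n / (2 * L) * (x + L)) * sin (pi * real n / (2 * L) * (t + L))"

text \<open>
  Chosen such that the spectral density at index \<open>n\<close> is proportional to \<open>exp (- (decay_rate l L * n)\<^sup>2)\<close>.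
\<close>
definition decay_rate :: "real \<Rightarrow> real \<Rightarrow> real" where
  "decay_rate l L = sqrt 2 * pi * l / (4 * L)"

lemma decay_rate_pos: "l > 0 \<Longrightarrow> L > 0 \<Longrightarrow> decay_rate l L > 0"
  by (simp add: decay_rate_def)

lemma decay_rate_exponent: "- l\<^sup>2 * (pi * a / (2 * L))\<^sup>2 / 2 = - (decay_rate l L * a)\<^sup>2"
  by (simp add: decay_rate_def power_mult_distrib power_divide)

lemma abs_sine_term_le:
  assumes "l > 0" "L > 0"
  shows "\<bar>sine_term l L x t n\<bar> \<le> sqrt (2 * pi) * l / L * exp (- (decay_rate l L * real n)\<^sup>2)"
proof -
  have "\<bar>sine_term l L x t n\<bar> = sqrt (2 * pi) * l / L * exp (- (decay_rate l L * real n)\<^sup>2)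
      * (\<bar>sin (pi * real n / (2 * L) * (x + L))\<bar> * \<bar>sin (pi * real n / (2 * L) * (t + L))\<bar>)"
    using assms unfolding sine_term_def decay_rate_exponent by (simp add: abs_mult)
  also have "\<dots> \<le> sqrt (2 * pi) * l / L * exp (- (decay_rate l L * real n)\<^sup>2) * (1 * 1)"
    using assms by (intro mult_left_mono mult_mono) auto
  finally show ?thesis by simp
qed

lemma summable_sine_term_majorant:
  assumes "l > 0" "L > 0"
  shows "summable (\<lambda>n. sqrt (2 * pi) * l / L * exp (- (decay_rate l L * real (Suc n))\<^sup>2))"
  using summable_exp_neg_square[OF decay_rate_pos[OF assms]] by (intro summable_mult) (simp add: add_ac)

lemma summable_sine_term:
  assumes "l > 0" "L > 0"
  shows "summable (\<lambda>n. \<bar>sine_term l L x t (Suc n)\<bar>)"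
proof (rule summable_comparison_test'[OF summable_sine_term_majorant[OF assms]])
  show "norm \<bar>sine_term l L x t (Suc n)\<bar> \<le> sqrt (2 * pi) * l / L * exp (- (decay_rate l L * real (Suc n))\<^sup>2)" for n
    using abs_sine_term_le[OF assms, of x t "Suc n"] by (simp only: real_norm_def abs_idempotent)
qed

text \<open>
  The integral bound for the majorant of the sine series does not depend on \<open>l\<close> and \<open>L\<close>. It bounds the
  series and all of its partial sums, which gives the factors \<open>2\<close> in the product estimates.
\<close>
lemma sine_majorant_mass:
  assumes "l > 0" "L > 0"
  shows "sqrt (2 * pi) * l / L * (sqrt pi / (2 * decay_rate l L)) = 2"
  using assms by (simp add: decay_rate_def real_sqrt_mult field_simps)

lemma abs_sum_sine_term_le_2:
  assumes "l > 0" "L > 0"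
  shows "\<bar>\<Sum>n<N. sine_term l L x t (Suc n)\<bar> \<le> 2"
proof -
  have "\<bar>\<Sum>n<N. sine_term l L x t (Suc n)\<bar> \<le> (\<Sum>n<N. sqrt (2 * pi) * l / L * exp (- (decay_rate l L * real (Suc n))\<^sup>2))"
    by (rule order_trans[OF sum_abs sum_mono]) (rule abs_sine_term_le[OF assms])
  also have "\<dots> = sqrt (2 * pi) * l / L * (\<Sum>n<N. exp (- (decay_rate l L * (real n + 1))\<^sup>2))"
    by (simp add: sum_distrib_left add_ac)
  also have "\<dots> \<le> sqrt (2 * pi) * l / L * (sqrt pi / (2 * decay_rate l L))"
    using assms by (intro mult_left_mono sum_exp_neg_square_le decay_rate_pos) auto
  also have "\<dots> = 2" by (rule sine_majorant_mass[OF assms])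
  finally show ?thesis .
qed

lemma abs_suminf_sine_term_le_2:
  assumes "l > 0" "L > 0"
  shows "\<bar>\<Sum>n. sine_term l L x t (Suc n)\<bar> \<le> 2"
proof (rule LIMSEQ_le_const2)
  show "(\<lambda>N. \<bar>\<Sum>n<N. sine_term l L x t (Suc n)\<bar>) \<longlonglongrightarrow> \<bar>\<Sum>n. sine_term l L x t (Suc n)\<bar>"
    by (intro tendsto_rabs summable_LIMSEQ summable_rabs_cancel[OF summable_sine_term] assms)
  show "\<exists>N. \<forall>n\<ge>N. \<bar>\<Sum>i<n. sine_term l L x t (Suc i)\<bar> \<le> 2"
    by (intro exI allI impI abs_sum_sine_term_le_2 assms)
qed

text \<open>
  The constant is the prefactor \<open>sqrt (2 \<pi>) l / L\<close> divided by \<open>2 s\<^sup>2\<close>, where \<open>s\<close> is the decay rate.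
\<close>
lemma abs_sine_series_tail_le:
  assumes l: "l > 0" and L: "L > 0" and m: "m \<ge> 1"
  shows "\<bar>(\<Sum>n. sine_term l L x t (Suc n)) - (\<Sum>n<m. sine_term l L x t (Suc n))\<bar>
    \<le> 4 * sqrt 2 / (pi powr (3 / 2) * l) * (L / real m) * exp (- (pi\<^sup>2 * l\<^sup>2 * (real m)\<^sup>2 / (8 * L\<^sup>2)))"
proof -
  let ?s = "decay_rate l L" and ?C = "sqrt (2 * pi) * l / L"
  have abs: "summable (\<lambda>n. \<bar>sine_term l L x t (Suc (n + m))\<bar>)"
    using summable_sine_term[OF l L, of x t] by (subst summable_iff_shift)
  have summ: "summable (\<lambda>n. exp (- (?s * (real (n + m) + 1))\<^sup>2))"
    using summable_exp_neg_square[OF decay_rate_pos[OF l L]] by (subst summable_iff_shift)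
  have "(\<Sum>n. sine_term l L x t (Suc n)) - (\<Sum>n<m. sine_term l L x t (Suc n)) = (\<Sum>n. sine_term l L x t (Suc (n + m)))"
    using suminf_split_initial_segment[OF summable_rabs_cancel[OF summable_sine_term[OF l L]], of x t m] by simp
  also have "\<bar>\<dots>\<bar> \<le> (\<Sum>n. \<bar>sine_term l L x t (Suc (n + m))\<bar>)"
    by (rule summable_rabs[OF abs])
  also have "\<dots> \<le> (\<Sum>n. ?C * exp (- (?s * (real (n + m) + 1))\<^sup>2))"
  proof (intro suminf_le abs summable_mult summ)
    show "\<bar>sine_term l L x t (Suc (n + m))\<bar> \<le> ?C * exp (- (?s * (real (n + m) + 1))\<^sup>2)" for n
      using abs_sine_term_le[OF l L, of x t "Suc (n + m)"] by (simp add: add_ac)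
  qed
  also have "\<dots> = ?C * (\<Sum>n. exp (- (?s * (real (n + m) + 1))\<^sup>2))"
    by (rule suminf_mult[OF summ])
  also have "\<dots> \<le> ?C * (exp (- (?s * real m)\<^sup>2) / (2 * ?s\<^sup>2 * real m))"
    using l L by (intro mult_left_mono suminf_exp_neg_square_tail_le decay_rate_pos m) auto
  also have "\<dots> = ?C / (2 * ?s\<^sup>2) / real m * exp (- (?s * real m)\<^sup>2)"
    by simp
  also have "?C / (2 * ?s\<^sup>2) = 4 * sqrt 2 / (pi powr (3 / 2) * l) * L"
  proof -
    have "pi powr (3 / 2) = pi powr (1 + 1 / 2)" by simp
    also have "\<dots> = pi * sqrt pi" by (subst powr_add) (simp add: powr_half_sqrt)
    finally have *: "pi powr (3 / 2) = pi * sqrt pi" .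
    have "?C / (2 * ?s\<^sup>2) = 4 * sqrt 2 * sqrt pi * L / (pi * pi * l)"
      using l L by (simp add: decay_rate_def real_sqrt_mult power2_eq_square field_simps)
    also have "\<dots> = 4 * sqrt 2 / (pi powr (3 / 2) * l) * L"
      using l by (simp add: * field_simps)
    finally show ?thesis .
  qed
  also have "- (?s * real m)\<^sup>2 = - (pi\<^sup>2 * l\<^sup>2 * (real m)\<^sup>2 / (8 * L\<^sup>2))"
    by (simp add: decay_rate_def power_mult_distrib power_divide)
  finally show ?thesis by simp
qed

text \<open>
  The product of sines is half of \<open>cos (w (x - t)) - cos (w (x + t + 2 L))\<close>, so the sine series is
  a difference of two cosine series. Up to a constant term, which cancels, each of them is a multiple
  of a periodised Gaussian of period \<open>4 L\<close>. This is the method of images: reflecting \<open>t\<close> at the ends of \<open>[- L, L]\<close> gives sources of alternating sign.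
\<close>
lemma suminf_sine_term_eq_images:
  fixes l L x t :: real
  assumes l: "l > 0" and L: "L > 0"
  defines "G \<equiv> \<lambda>u. gauss_tail l (4 * L) u + gauss_tail l (4 * L) (4 * L - u)"
  shows "(\<Sum>n. sine_term l L x t (Suc n)) = G (x - t) - G (x + t + 2 * L)"
proof -
  let ?e = "\<lambda>n. exp (- (decay_rate l L * (real n + 1))\<^sup>2)"
  define cs where "cs = (\<lambda>u n. ?e n * cos (2 * pi * (real n + 1) / (4 * L) * u))"
  have G: "G u = sqrt (2 * pi) * l / (4 * L) * (1 + 2 * (\<Sum>n. cs u n))" for u
    unfolding G_def cs_def decay_rate_def using gauss_periodized_eq_cosine_series[of l "4 * L" u] l L by simp
  have sum_cs: "summable (cs u)" for u
    unfolding cs_def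
    by (rule summable_comparison_test'[OF summable_exp_neg_square[OF decay_rate_pos[OF l L]]])
       (auto simp: abs_mult mult_left_le)
  have "sine_term l L x t (Suc n) = sqrt (2 * pi) * l / (2 * L) * (cs (x - t) n - cs (x + t + 2 * L) n)" for n
  proof -
    let ?w = "2 * pi * (real n + 1) / (4 * L)"
    have w: "pi * real (Suc n) / (2 * L) = ?w" using L by (simp add: field_simps)
    have "sin (?w * (x + L)) * sin (?w * (t + L)) = (cos (?w * (x - t)) - cos (?w * (x + t + 2 * L))) / 2"
    proof -
      have "?w * (x + L) - ?w * (t + L) = ?w * (x - t)" "?w * (x + L) + ?w * (t + L) = ?w * (x + t + 2 * L)"
        by (simp_all only: distrib_left[symmetric] right_diff_distrib[symmetric]) (simp_all add: add_ac)
      then show ?thesis by (simp only: sin_times_sin)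
    qed
    moreover have "exp (- l\<^sup>2 * (pi * real (Suc n) / (2 * L))\<^sup>2 / 2) = ?e n"
      by (simp only: decay_rate_exponent of_nat_Suc add.commute)
    ultimately have "sine_term l L x t (Suc n) = sqrt (2 * pi) * l / L * ?e n * ((cos (?w * (x - t)) - cos (?w * (x + t + 2 * L))) / 2)"
      unfolding sine_term_def w by (simp only: mult.assoc)
    moreover have "K / L * e * ((a - b) / 2) = K / (2 * L) * (e * a - e * b)" for K e a b :: real
      by (simp add: field_simps)
    ultimately show ?thesis unfolding cs_def by (simp only:)
  qed
  then have "(\<Sum>n. sine_term l L x t (Suc n)) = (\<Sum>n. sqrt (2 * pi) * l / (2 * L) * (cs (x - t) n - cs (x + t + 2 * L) n))"
    by simp
  also have "\<dots> = sqrt (2 * pi) * l / (2 * L) * (suminf (cs (x - t)) - suminf (cs (x + t + 2 * L)))"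
    by (simp only: suminf_mult[OF summable_diff[OF sum_cs sum_cs]] suminf_diff[OF sum_cs sum_cs])
  also have "\<dots> = G (x - t) - G (x + t + 2 * L)"
  proof -
    have "K / (2 * L) * (a - b) = K / (4 * L) * (1 + 2 * a) - K / (4 * L) * (1 + 2 * b)" for K a b :: real
      using L by (simp add: field_simps)
    then show ?thesis unfolding G .
  qed
  finally show ?thesis .
qed

text \<open>
  Apart from \<open>t\<close> itself, all images lie at distance at least \<open>2 (L - B)\<close> from \<open>x\<close>. They form four
  half lattices, two of each sign, so that at most two of the four tails add up.
\<close>
lemma abs_sine_series_minus_gauss_le:
  fixes l L B x t :: real
  assumes l: "l > 0" and B: "B < L" and x: "\<bar>x\<bar> < B" and t: "\<bar>t\<bar> < B"
  shows "\<bar>(\<Sum>n. sine_term l L x t (Suc n)) - exp (- (x - t)\<^sup>2 / (2 * l\<^sup>2))\<bar>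
    \<le> (2 + sqrt (2 * pi) * l / (4 * L)) * exp (- (2 * (L - B)\<^sup>2 / l\<^sup>2))"
proof -
  have L: "L > 0" using B x by linarith
  let ?H = "gauss_tail l (4 * L)"
  define E where "E = exp (- (2 * (L - B))\<^sup>2 / (2 * l\<^sup>2)) * (1 + sqrt (2 * pi) * l / (2 * (4 * L)))"
  have H: "0 \<le> ?H u" "2 * (L - B) \<le> u \<Longrightarrow> ?H u \<le> E" for u
    using l L B gauss_tail_nonneg[of l "4 * L" u] gauss_tail_le[of l "4 * L" "2 * (L - B)" u]
    unfolding E_def by simp_all
  have "(\<Sum>n. sine_term l L x t (Suc n)) - exp (- (x - t)\<^sup>2 / (2 * l\<^sup>2))
    = (?H (x - t + 4 * L) + ?H (4 * L - (x - t))) - (?H (x + t + 2 * L) + ?H (4 * L - (x + t + 2 * L)))"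
    unfolding suminf_sine_term_eq_images[OF l L] using gauss_tail_rec[of l "4 * L" "x - t"] l L by simp
  also have "\<bar>\<dots>\<bar> \<le> 2 * E"
  proof -
    have "2 * (L - B) \<le> x - t + 4 * L" "2 * (L - B) \<le> 4 * L - (x - t)"
      "2 * (L - B) \<le> x + t + 2 * L" "2 * (L - B) \<le> 4 * L - (x + t + 2 * L)"
      using x t B by (simp_all add: abs_less_iff)
    from this[THEN H(2)] H(1)[of "x - t + 4 * L"] H(1)[of "4 * L - (x - t)"]
      H(1)[of "x + t + 2 * L"] H(1)[of "4 * L - (x + t + 2 * L)"]
    show ?thesis unfolding abs_le_iff by linarith
  qed
  also have "2 * E = (2 + sqrt (2 * pi) * l / (4 * L)) * exp (- (2 * (L - B)\<^sup>2 / l\<^sup>2))"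
  proof -
    have "- (2 * (L - B))\<^sup>2 / (2 * l\<^sup>2) = - (2 * (L - B)\<^sup>2 / l\<^sup>2)"
      unfolding power_mult_distrib by simp
    then show ?thesis unfolding E_def by (simp only:) (simp add: distrib_left distrib_right)
  qed
  finally show ?thesis .
qed

section \<open>Products over the coordinates\<close>

text \<open>
  Dividing all factors by \<open>K\<close> reduces this to factors of absolute value at most one, where the
  distance of the products is at most the sum of the distances of the factors.
\<close>
lemma abs_prod_diff_le:
  fixes a b :: "'i \<Rightarrow> real"
  assumes K: "K > 0"
    and "\<And>i. i \<in> I \<Longrightarrow> \<bar>a i\<bar> \<le> K" "\<And>i. i \<in> I \<Longrightarrow> \<bar>b i\<bar> \<le> K" "\<And>i. i \<in> I \<Longrightarrow> \<bar>a i - b i\<bar> \<le> \<epsilon>"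
  shows "\<bar>(\<Prod>i\<in>I. a i) - (\<Prod>i\<in>I. b i)\<bar> \<le> real (card I) * K ^ (card I - 1) * \<epsilon>"
proof (cases "card I")
  case 0
  then show ?thesis by (auto simp: card_eq_0_iff)
next
  case (Suc k)
  have "(\<Prod>i\<in>I. a i) - (\<Prod>i\<in>I. b i) = K ^ Suc k * ((\<Prod>i\<in>I. a i / K) - (\<Prod>i\<in>I. b i / K))"
    using K Suc by (simp add: prod_dividef right_diff_distrib)
  then have "\<bar>(\<Prod>i\<in>I. a i) - (\<Prod>i\<in>I. b i)\<bar> = K ^ Suc k * \<bar>(\<Prod>i\<in>I. a i / K) - (\<Prod>i\<in>I. b i / K)\<bar>"
    using K by (simp add: abs_mult)
  also have "\<bar>(\<Prod>i\<in>I. a i / K) - (\<Prod>i\<in>I. b i / K)\<bar> \<le> (\<Sum>i\<in>I. \<bar>a i / K - b i / K\<bar>)"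
    using norm_prod_diff[of I "\<lambda>i. a i / K" "\<lambda>i. b i / K"] assms by simp
  also have "\<dots> \<le> (\<Sum>i\<in>I. \<epsilon> / K)"
    using assms by (intro sum_mono) (simp add: diff_divide_distrib[symmetric] divide_right_mono)
  also have "K ^ Suc k * (\<Sum>i\<in>I. \<epsilon> / K) = real (card I) * K ^ (card I - 1) * \<epsilon>"
    using K Suc by simp
  finally show ?thesis using K by (simp add: mult_left_mono)
qed

lemma hsgp_term_gaussian_eq_prod:
  fixes x t :: "real^'d"
  assumes l: "l > 0" and L: "L > 0"
  shows "hsgp_term (gaussian_kernel \<sigma> l) L x t j = \<sigma>\<^sup>2 * (\<Prod>r\<in>UNIV. sine_term l L (x $ r) (t $ r) (j $ r))"
proof -
  let ?d = "CARD('d)"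
  have "(norm (hsgp_frequency L j))\<^sup>2 = (\<Sum>r\<in>UNIV. (pi * real (j $ r) / (2 * L))\<^sup>2)"
    by (simp add: hsgp_frequency_def norm_vec_def L2_set_def sum_nonneg power_divide)
  then have E: "exp (- l\<^sup>2 * (norm (hsgp_frequency L j))\<^sup>2 / 2) = (\<Prod>r\<in>UNIV. exp (- l\<^sup>2 * (pi * real (j $ r) / (2 * L))\<^sup>2 / 2))"
    by (simp add: sum_divide_distrib sum_negf sum_distrib_left flip: exp_sum)
  have S: "(2 * pi) powr (real ?d / 2) = sqrt (2 * pi) ^ ?d"
    by (simp add: powr_half_sqrt[symmetric] powr_powr powr_realpow[symmetric])
  have M: "L powr (- real ?d / 2) * L powr (- real ?d / 2) = 1 / L ^ ?d"
  proof -
    have "L powr (- real ?d / 2) * L powr (- real ?d / 2) = L powr (- real ?d / 2 + - real ?d / 2)"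
      by (rule powr_add[symmetric])
    also have "- real ?d / 2 + - real ?d / 2 = - real ?d" by simp
    also have "L powr (- real ?d) = 1 / L powr real ?d" by (rule powr_minus_divide)
    also have "L powr real ?d = L ^ ?d" using L by (rule powr_realpow)
    finally show ?thesis .
  qed
  have const: "(\<Prod>r\<in>(UNIV::'d set). sqrt (2 * pi) * l / L) = sqrt (2 * pi) ^ ?d * l ^ ?d * (1 / L ^ ?d)"
    by (simp add: power_mult_distrib power_divide)
  show ?thesis
    unfolding hsgp_term_def spectral_density_gaussian[OF l] sine_basis_def E S
    unfolding sine_term_def prod.distrib const M[symmetric]
    by (simp only: mult_ac)
qed

text \<open>
  Stated for an arbitrary index set \<open>J\<close> in each coordinate, so that it applies both to the full and to
  the truncated expansion.
\<close>
lemma infsum_hsgp_term_gaussian: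
  fixes x t :: "real^'d"
  assumes l: "l > 0" and L: "L > 0"
  shows "(\<Sum>\<^sub>\<infinity>j\<in>{j. \<forall>r. j $ r \<in> J}. hsgp_term (gaussian_kernel \<sigma> l) L x t j)
    = \<sigma>\<^sup>2 * (\<Prod>r\<in>UNIV. \<Sum>\<^sub>\<infinity>n\<in>J. sine_term l L (x $ r) (t $ r) n)"
proof -
  let ?f = "\<lambda>r. sine_term l L (x $ r) (t $ r)"
  have "(\<lambda>n. \<bar>?f r n\<bar>) summable_on UNIV" for r
    using summable_sine_term[OF l L] by (intro summable_nonneg_imp_summable_on) (subst summable_Suc_iff[symmetric], auto)
  then have abs: "(\<lambda>n. norm (?f r n)) summable_on J" for r
    by (auto intro: summable_on_subset_banach)
  have bij: "bij_betw vec_nth {j::nat^'d. \<forall>r. j $ r \<in> J} (\<Pi>\<^sub>E r\<in>UNIV. J)"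
    by (rule bij_betw_byWitness[where f' = vec_lambda]) auto
  have "(\<Sum>\<^sub>\<infinity>j\<in>{j. \<forall>r. j $ r \<in> J}. hsgp_term (gaussian_kernel \<sigma> l) L x t j)
    = \<sigma>\<^sup>2 * (\<Sum>\<^sub>\<infinity>j\<in>{j. \<forall>r. j $ r \<in> J}. \<Prod>r\<in>UNIV. ?f r (vec_nth j r))"
    unfolding hsgp_term_gaussian_eq_prod[OF l L] by (rule infsum_cmult_right')
  also have "(\<Sum>\<^sub>\<infinity>j\<in>{j. \<forall>r. j $ r \<in> J}. \<Prod>r\<in>UNIV. ?f r (vec_nth j r)) = (\<Sum>\<^sub>\<infinity>g\<in>(\<Pi>\<^sub>E r\<in>UNIV. J). \<Prod>r\<in>UNIV. ?f r (g r))"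
    by (rule infsum_reindex_bij_betw[OF bij])
  also have "\<dots> = (\<Prod>r\<in>UNIV. \<Sum>\<^sub>\<infinity>n\<in>J. ?f r n)"
    by (intro infsum_prod_PiE_abs abs) simp
  finally show ?thesis .
qed

lemma hsgp_infinite_gaussian:
  fixes x t :: "real^'d"
  assumes l: "l > 0" and L: "L > 0"
  shows "hsgp_infinite (gaussian_kernel \<sigma> l) L x t = \<sigma>\<^sup>2 * (\<Prod>r\<in>UNIV. \<Sum>n. sine_term l L (x $ r) (t $ r) (Suc n))"
proof -
  have "(\<Sum>\<^sub>\<infinity>n\<in>{1..}. sine_term l L a b n) = (\<Sum>n. sine_term l L a b (Suc n))" for a b
  proof -
    have "{1..} = range Suc" by (auto simp: image_iff Suc_le_eq gr0_conv_Suc)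
    then have "(\<Sum>\<^sub>\<infinity>n\<in>{1..}. sine_term l L a b n) = (\<Sum>\<^sub>\<infinity>n. sine_term l L a b (Suc n))"
      by (simp add: infsum_reindex o_def)
    also have "\<dots> = (\<Sum>n. sine_term l L a b (Suc n))"
      using summable_sine_term[OF l L, of a b]
      by (intro infsumI norm_summable_imp_has_sum) (auto intro: summable_sums summable_rabs_cancel[OF summable_sine_term] l L)
    finally show ?thesis .
  qed
  then show ?thesis
    using infsum_hsgp_term_gaussian[OF l L, where J = "{1..}" and \<sigma> = \<sigma> and x = x and t = t] by (simp add: hsgp_infinite_def)
qed

lemma hsgp_truncated_gaussian:
  fixes x t :: "real^'d"
  assumes l: "l > 0" and L: "L > 0"
  shows "hsgp_truncated (gaussian_kernel \<sigma> l) L m x t = \<sigma>\<^sup>2 * (\<Prod>r\<in>UNIV. \<Sum>n<m. sine_term l L (x $ r) (t $ r) (Suc n))"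
proof -
  have "(\<Sum>n\<in>{1..m}. sine_term l L a b n) = (\<Sum>n<m. sine_term l L a b (Suc n))" for a b
    by (simp add: sum.atLeast1_atMost_eq)
  then show ?thesis
    using infsum_hsgp_term_gaussian[OF l L, where J = "{1..m}" and \<sigma> = \<sigma> and x = x and t = t]
    by (simp add: hsgp_truncated_def finite_multi_indices[simplified])
qed

lemma gaussian_kernel_eq_prod:
  fixes x t :: "real^'d"
  shows "gaussian_kernel \<sigma> l x t = \<sigma>\<^sup>2 * (\<Prod>r\<in>UNIV. exp (- (x $ r - t $ r)\<^sup>2 / (2 * l\<^sup>2)))"
proof -
  have "(norm (x - t))\<^sup>2 = (\<Sum>r\<in>UNIV. (x $ r - t $ r)\<^sup>2)"
    by (simp add: norm_vec_def L2_set_def sum_nonneg)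
  then show ?thesis
    by (simp add: gaussian_kernel_def sum_divide_distrib sum_negf flip: exp_sum)
qed

section \<open>The error bounds\<close>

lemma abs_square_mult_diff: "\<bar>(\<sigma>::real)\<^sup>2 * a - \<sigma>\<^sup>2 * b\<bar> = \<sigma>\<^sup>2 * \<bar>a - b\<bar>"
  by (simp only: right_diff_distrib[symmetric] abs_mult abs_power2)

lemma abs_hsgp_infinite_minus_kernel_le:
  fixes x t :: "real^'d"
  assumes l: "l > 0" and B: "B < L" and x: "\<And>r. \<bar>x $ r\<bar> < B" and t: "\<And>r. \<bar>t $ r\<bar> < B"
  shows "\<bar>hsgp_infinite (gaussian_kernel \<sigma> l) L x t - gaussian_kernel \<sigma> l x t\<bar>
    \<le> \<sigma>\<^sup>2 * (real CARD('d) * 2 ^ (CARD('d) - 1) * ((2 + sqrt (2 * pi) * l / (4 * L)) * exp (- (2 * (L - B)\<^sup>2 / l\<^sup>2))))"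
proof -
  have L: "L > 0" using B x[of undefined] by linarith
  have "\<bar>hsgp_infinite (gaussian_kernel \<sigma> l) L x t - gaussian_kernel \<sigma> l x t\<bar>
    = \<sigma>\<^sup>2 * \<bar>(\<Prod>r\<in>UNIV. \<Sum>n. sine_term l L (x $ r) (t $ r) (Suc n)) - (\<Prod>r\<in>UNIV. exp (- (x $ r - t $ r)\<^sup>2 / (2 * l\<^sup>2)))\<bar>"
    unfolding hsgp_infinite_gaussian[OF l L] gaussian_kernel_eq_prod by (rule abs_square_mult_diff)
  also have "\<dots> \<le> \<sigma>\<^sup>2 * (real CARD('d) * 2 ^ (CARD('d) - 1) * ((2 + sqrt (2 * pi) * l / (4 * L)) * exp (- (2 * (L - B)\<^sup>2 / l\<^sup>2))))"
  proof (intro mult_left_mono abs_prod_diff_le abs_suminf_sine_term_le_2 abs_sine_series_minus_gauss_le l L B x t)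
    show "\<bar>exp (- (x $ r - t $ r)\<^sup>2 / (2 * l\<^sup>2))\<bar> \<le> 2" for r
      by (rule order_trans[of _ 1]) simp_all
  qed simp_all
  finally show ?thesis .
qed

lemma abs_hsgp_infinite_minus_truncated_le:
  fixes x t :: "real^'d"
  assumes l: "l > 0" and L: "L > 0" and m: "m \<ge> 1"
  shows "\<bar>hsgp_infinite (gaussian_kernel \<sigma> l) L x t - hsgp_truncated (gaussian_kernel \<sigma> l) L m x t\<bar>
    \<le> \<sigma>\<^sup>2 * (real CARD('d) * 2 ^ (CARD('d) - 1)
      * (4 * sqrt 2 / (pi powr (3 / 2) * l) * (L / real m) * exp (- (pi\<^sup>2 * l\<^sup>2 * (real m)\<^sup>2 / (8 * L\<^sup>2)))))"
proof -
  have "\<bar>hsgp_infinite (gaussian_kernel \<sigma> l) L x t - hsgp_truncated (gaussian_kernel \<sigma> l) L m x t\<bar>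
    = \<sigma>\<^sup>2 * \<bar>(\<Prod>r\<in>UNIV. \<Sum>n. sine_term l L (x $ r) (t $ r) (Suc n)) - (\<Prod>r\<in>UNIV. \<Sum>n<m. sine_term l L (x $ r) (t $ r) (Suc n))\<bar>"
    unfolding hsgp_infinite_gaussian[OF l L] hsgp_truncated_gaussian[OF l L] by (rule abs_square_mult_diff)
  also have "\<dots> \<le> \<sigma>\<^sup>2 * (real CARD('d) * 2 ^ (CARD('d) - 1)
      * (4 * sqrt 2 / (pi powr (3 / 2) * l) * (L / real m) * exp (- (pi\<^sup>2 * l\<^sup>2 * (real m)\<^sup>2 / (8 * L\<^sup>2)))))"
    by (intro mult_left_mono abs_prod_diff_le abs_suminf_sine_term_le_2 abs_sum_sine_term_le_2 abs_sine_series_tail_le l L m)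
       simp_all
  finally show ?thesis .
qed

theorem theorem4:
  fixes \<sigma> l B L :: real and \<Omega> :: "(real^'d) set"
  assumes "\<Omega> = box (\<chi> r. - B) (\<chi> r. B)"
    and "B > 0" and "\<sigma>\<^sup>2 > 0" and "l > 0" and "L > B"
  shows "(SUP (x, t) \<in> \<Omega> \<times> \<Omega>.
            ereal \<bar>hsgp_infinite (gaussian_kernel \<sigma> l) L x t - gaussian_kernel \<sigma> l x t\<bar>)
         \<le> ereal (\<sigma>\<^sup>2 * (2 ^ CARD('d) + 2 * real CARD('d) - 1)
              * (3 + sqrt (2 * pi) * l / (4 * L)) ^ CARD('d)
              * exp (- (2 * (L - B)\<^sup>2 / l\<^sup>2)))
       \<and> (L > l * sqrt (pi / 2) \<longrightarrow> (\<forall>m::nat. m \<ge> 1 \<longrightarrow>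
           (SUP (x, t) \<in> \<Omega> \<times> \<Omega>.
              ereal \<bar>hsgp_infinite (gaussian_kernel \<sigma> l) L x t
                     - hsgp_truncated (gaussian_kernel \<sigma> l) L m x t\<bar>)
           \<le> ereal (4 * sqrt 2 / (pi powr (3 / 2) * l) * 3 ^ (CARD('d) - 1) * real CARD('d)
                * \<sigma>\<^sup>2 * (L / real m) * exp (- (pi\<^sup>2 * l\<^sup>2 * (real m)\<^sup>2 / (8 * L\<^sup>2))))))"
proof (intro conjI impI allI)
  let ?d = "CARD('d)"
  have l: "l > 0" and B: "B < L" and L: "L > 0" using assms by simp_all
  have \<Omega>: "\<bar>x $ r\<bar> < B" if "x \<in> \<Omega>" for x r
  proof -
    have "- B < x $ r \<and> x $ r < B" using that by (simp add: assms(1) mem_box_cart)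
    then show ?thesis by linarith
  qed
  have d: "Suc (?d - 1) = ?d" by simp
  show "(SUP (x, t) \<in> \<Omega> \<times> \<Omega>. ereal \<bar>hsgp_infinite (gaussian_kernel \<sigma> l) L x t - gaussian_kernel \<sigma> l x t\<bar>)
    \<le> ereal (\<sigma>\<^sup>2 * (2 ^ ?d + 2 * real ?d - 1) * (3 + sqrt (2 * pi) * l / (4 * L)) ^ ?d * exp (- (2 * (L - B)\<^sup>2 / l\<^sup>2)))"
  proof (rule SUP_least)
    fix p assume "p \<in> \<Omega> \<times> \<Omega>"
    then obtain x t where p: "p = (x, t)" and "x \<in> \<Omega>" "t \<in> \<Omega>" by blast
    define c E where "c = sqrt (2 * pi) * l / (4 * L)" and "E = exp (- (2 * (L - B)\<^sup>2 / l\<^sup>2))"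
    have c: "c \<ge> 0" using l L by (simp add: c_def)
    have "real ?d * 2 ^ (?d - 1) * ((2 + c) * E) \<le> real ?d * (3 + c) ^ (?d - 1) * ((3 + c) * E)"
      using c by (intro mult_mono power_mono) (auto simp: E_def)
    also have "\<dots> = real ?d * (3 + c) ^ ?d * E"
      using power_Suc[of "3 + c" "?d - 1"] unfolding d by (simp only: mult_ac)
    also have "\<dots> \<le> (2 ^ ?d + 2 * real ?d - 1) * (3 + c) ^ ?d * E"
    proof -
      have "(1::real) \<le> 2 ^ ?d" by simp
      then have "real ?d \<le> 2 ^ ?d + 2 * real ?d - 1" by linarith
      then show ?thesis using c by (intro mult_right_mono) (auto simp: E_def)
    qed
    finally have "\<sigma>\<^sup>2 * (real ?d * 2 ^ (?d - 1) * ((2 + c) * E)) \<le> \<sigma>\<^sup>2 * ((2 ^ ?d + 2 * real ?d - 1) * (3 + c) ^ ?d * E)"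
      by (rule mult_left_mono) simp
    with abs_hsgp_infinite_minus_kernel_le[OF l B \<Omega>[OF \<open>x \<in> \<Omega>\<close>] \<Omega>[OF \<open>t \<in> \<Omega>\<close>], of \<sigma>]
    have "\<bar>hsgp_infinite (gaussian_kernel \<sigma> l) L x t - gaussian_kernel \<sigma> l x t\<bar>
      \<le> \<sigma>\<^sup>2 * (2 ^ ?d + 2 * real ?d - 1) * (3 + sqrt (2 * pi) * l / (4 * L)) ^ ?d * exp (- (2 * (L - B)\<^sup>2 / l\<^sup>2))"
      unfolding c_def[symmetric] E_def[symmetric] mult.assoc by (rule order_trans)
    then show "(case p of (x, t) \<Rightarrow> ereal \<bar>hsgp_infinite (gaussian_kernel \<sigma> l) L x t - gaussian_kernel \<sigma> l x t\<bar>)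
      \<le> ereal (\<sigma>\<^sup>2 * (2 ^ ?d + 2 * real ?d - 1) * (3 + sqrt (2 * pi) * l / (4 * L)) ^ ?d * exp (- (2 * (L - B)\<^sup>2 / l\<^sup>2)))"
      by (simp only: p prod.case ereal_less_eq)
  qed
  fix m :: nat assume m: "m \<ge> 1"
  show "(SUP (x, t) \<in> \<Omega> \<times> \<Omega>. ereal \<bar>hsgp_infinite (gaussian_kernel \<sigma> l) L x t - hsgp_truncated (gaussian_kernel \<sigma> l) L m x t\<bar>)
    \<le> ereal (4 * sqrt 2 / (pi powr (3 / 2) * l) * 3 ^ (?d - 1) * real ?d
         * \<sigma>\<^sup>2 * (L / real m) * exp (- (pi\<^sup>2 * l\<^sup>2 * (real m)\<^sup>2 / (8 * L\<^sup>2))))"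
  proof (rule SUP_least)
    fix p assume "p \<in> \<Omega> \<times> \<Omega>"
    then obtain x t where p: "p = (x, t)" and "x \<in> \<Omega>" "t \<in> \<Omega>" by blast
    define q where "q = 4 * sqrt 2 / (pi powr (3 / 2) * l)"
    define E where "E = exp (- (pi\<^sup>2 * l\<^sup>2 * (real m)\<^sup>2 / (8 * L\<^sup>2)))"
    have "\<sigma>\<^sup>2 * (real ?d * 2 ^ (?d - 1) * (q * (L / real m) * E)) \<le> \<sigma>\<^sup>2 * (real ?d * 3 ^ (?d - 1) * (q * (L / real m) * E))"
      using l L by (intro mult_left_mono mult_right_mono power_mono) (auto simp: q_def E_def)
    with abs_hsgp_infinite_minus_truncated_le[OF l L m, of \<sigma> x t]
    have "\<bar>hsgp_infinite (gaussian_kernel \<sigma> l) L x t - hsgp_truncated (gaussian_kernel \<sigma> l) L m x t\<bar>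
      \<le> 4 * sqrt 2 / (pi powr (3 / 2) * l) * 3 ^ (?d - 1) * real ?d
         * \<sigma>\<^sup>2 * (L / real m) * exp (- (pi\<^sup>2 * l\<^sup>2 * (real m)\<^sup>2 / (8 * L\<^sup>2)))"
      unfolding q_def[symmetric] E_def[symmetric] by (simp only: mult_ac)
    then show "(case p of (x, t) \<Rightarrow> ereal \<bar>hsgp_infinite (gaussian_kernel \<sigma> l) L x t - hsgp_truncated (gaussian_kernel \<sigma> l) L m x t\<bar>)
      \<le> ereal (4 * sqrt 2 / (pi powr (3 / 2) * l) * 3 ^ (?d - 1) * real ?d
         * \<sigma>\<^sup>2 * (L / real m) * exp (- (pi\<^sup>2 * l\<^sup>2 * (real m)\<^sup>2 / (8 * L\<^sup>2))))"
      by (simp only: p prod.case ereal_less_eq)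
  qed
qed

end
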